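(* Let $d\geq 3$ and let $\mathcal{F}=V(x^d+y^d+z^d)\subset\mathbb{P}^2$ be the Fermat curve of degree $d$ over $\mathbb{C}$. Let $u$ be a primitive $2d$-th root of unity and $\zeta$ a primitive $d$-th root of unity. The $3d^2$ sextactic points on $\mathcal{F}$ are organized in three clusters of $d^2$ points: the points $$s_{j,k}=(\zeta^j:1:u^{-k}2^{1/d}),\qquad j\in\{0,\dots,d-1\},\ k \text{ odd},\ 0<k<2d,$$ and the two further sets of $d^2$ points obtained from these by permutation of the coordinates. The $d^2$ points $s_{j,k}$ are distributed with $d$ points on each of the $3d$ lines in $$\mathcal{B}_z=V(x^d-y^d),\quad \mathcal{M}_x=V(z^d+2y^d),\quad \mathcal{N}_y=V(z^d+2x^d).$$ Moreover, the intersection points of these $3d$ lines are exactly: $d^2$ ordinary triple points, located at the sextactic points $s_{j,k}$, and three ordinary $d$-fold points, located at $(1:0:0)$, $(0:1:0)$ and $(0:0:1)$.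
   Context: Each of $\mathcal{B}_z,\mathcal{M}_x,\mathcal{N}_y$ is a union of $d$ lines, since the defining form is a binary form of degree $d$. An (ordinary) $m$-fold point of a line arrangement is a point through which exactly $m$ of the lines pass. The osculating conic $O_p$ to $\mathcal{F}$ at $p$ is the unique conic with intersection multiplicity $(O_p.\mathcal{F})_p\geq 5$; it is hyperosculating if $(O_p.\mathcal{F})_p\geq 6$. An inflection point is a point $p$ whose tangent line meets $\mathcal{F}$ at $p$ with multiplicity at least $3$. A sextactic point is a point of $\mathcal{F}$ that is not an inflection point and at which the osculating conic is hyperosculating. $2^{1/d}$ denotes the positive real $d$-th root of $2$. *)

theory Defs
  imports
    "HOL-Analysis.Cartesian_Space"
    "HOL-Computational_Algebra.Polynomial"
    "HOL-Computational_Algebra.Fraction_Field"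
    "HOL-Library.Extended_Nat"
    "HOL-Library.Disjoint_Sets"
begin

section \<open>Ternary polynomials and forms\<close>

text \<open>The ring \<open>\<complex>[x,y,z]\<close> is represented as \<open>\<complex>[x][y][z]\<close>: the outermost variable is \<open>z\<close>.\<close>

type_synonym poly3 = "complex poly poly poly"

definition PC :: "complex \<Rightarrow> poly3" where "PC c = [:[:[:c:]:]:]"
definition PX :: poly3 where "PX = [:[:[:0, 1:]:]:]"
definition PY :: poly3 where "PY = [:[:0, 1:]:]"
definition PZ :: poly3 where "PZ = [:0, 1:]"

definition eval3 :: "poly3 \<Rightarrow> complex ^ 3 \<Rightarrow> complex" where
  "eval3 P v = poly (poly (poly P [:[:v $ 3:]:]) [:v $ 2:]) (v $ 1)"

definition dX :: "poly3 \<Rightarrow> poly3" where "dX = map_poly (map_poly pderiv)"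
definition dY :: "poly3 \<Rightarrow> poly3" where "dY = map_poly pderiv"
definition dZ :: "poly3 \<Rightarrow> poly3" where "dZ = pderiv"

text \<open>The zero polynomial is a form of every degree.\<close>

definition form :: "nat \<Rightarrow> poly3 \<Rightarrow> bool" where
  "form n P \<longleftrightarrow> (\<forall>i j k. coeff (coeff (coeff P k) j) i \<noteq> 0 \<longrightarrow> i + j + k = n)"

section \<open>The projective plane\<close>

text \<open>Points of the plane are the one-dimensional linear subspaces of \<open>\<complex>\<^sup>3\<close>.\<close>

definition proj_plane :: "(complex ^ 3) set set" where
  "proj_plane = {p. vec.subspace p \<and> vec.dim p = 1}"

definition hpoint :: "complex \<Rightarrow> complex \<Rightarrow> complex \<Rightarrow> (complex ^ 3) set" where
  "hpoint a b c = vec.span {vector [a, b, c]}"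

definition permute_coords :: "(3 \<Rightarrow> 3) \<Rightarrow> (complex ^ 3) set \<Rightarrow> (complex ^ 3) set" where
  "permute_coords \<sigma> p = (\<lambda>v. \<chi> i. v $ \<sigma> i) ` p"

definition zero_locus :: "poly3 \<Rightarrow> (complex ^ 3) set set" where
  "zero_locus F = {p \<in> proj_plane. \<forall>v\<in>p. eval3 F v = 0}"

section \<open>Intersection multiplicity\<close>

text \<open>
  The intersection multiplicity of the curves \<open>F = 0\<close> and \<open>G = 0\<close> at \<open>p\<close> is the dimension of
  \<open>\<O>\<^sub>p / (F\<^sub>*, G\<^sub>*)\<close> over \<open>\<complex>\<close>. Here \<open>\<O>\<^sub>p\<close> is the local ring of the plane at \<open>p\<close>, whose elements are
  the quotients \<open>a/b\<close> of forms of equal degree with \<open>b\<close> not vanishing at \<open>p\<close>, and \<open>F\<^sub>* = F/b\<close> for a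
  form \<open>b\<close> of degree \<open>deg F\<close> not vanishing at \<open>p\<close>. Different choices of \<open>b\<close> change \<open>F\<^sub>*\<close> by a
  unit of \<open>\<O>\<^sub>p\<close>, so all of them are admitted as generators.
\<close>

definition nonvanishing_at :: "(complex ^ 3) set \<Rightarrow> poly3 \<Rightarrow> bool" where
  "nonvanishing_at p b \<longleftrightarrow> (\<exists>v\<in>p. eval3 b v \<noteq> 0)"

definition local_ring :: "(complex ^ 3) set \<Rightarrow> poly3 fract set" where
  "local_ring p = {Fract a b | a b n. form n a \<and> form n b \<and> nonvanishing_at p b}"

definition local_equations :: "(complex ^ 3) set \<Rightarrow> poly3 \<Rightarrow> poly3 fract set" where
  "local_equations p F = {Fract F b | b n. form n F \<and> form n b \<and> nonvanishing_at p b}"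

definition local_ideal :: "(complex ^ 3) set \<Rightarrow> poly3 \<Rightarrow> poly3 \<Rightarrow> poly3 fract set" where
  "local_ideal p F G =
     {r * f + s * g | r s f g. r \<in> local_ring p \<and> s \<in> local_ring p \<and>
        f \<in> local_equations p F \<and> g \<in> local_equations p G}"

text \<open>
  The dimension of the complex vector space \<open>V / W\<close> is the supremum of the sizes of the finite
  subsets of \<open>V\<close> that are linearly independent modulo \<open>W\<close>.
\<close>

definition quotient_dim :: "poly3 fract set \<Rightarrow> poly3 fract set \<Rightarrow> enat" where
  "quotient_dim V W =
     (SUP B \<in> {B. finite B \<and> B \<subseteq> V \<and>
                  (\<forall>c. (\<Sum>b\<in>B. Fract (PC (c b)) 1 * b) \<in> W \<longrightarrow> (\<forall>b\<in>B. c b = 0))}.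
        enat (card B))"

definition intersection_mult :: "(complex ^ 3) set \<Rightarrow> poly3 \<Rightarrow> poly3 \<Rightarrow> enat" where
  "intersection_mult p F G = quotient_dim (local_ring p) (local_ideal p F G)"

section \<open>Inflection points and sextactic points\<close>

text \<open>
  In the following, \<open>F\<close> is the defining form of a smooth curve. The linear form below defines
  its tangent line at the point spanned by \<open>v\<close>.
\<close>

definition tangent_form :: "poly3 \<Rightarrow> complex ^ 3 \<Rightarrow> poly3" where
  "tangent_form F v =
     PC (eval3 (dX F) v) * PX + PC (eval3 (dY F) v) * PY + PC (eval3 (dZ F) v) * PZ"

definition inflection_point :: "poly3 \<Rightarrow> (complex ^ 3) set \<Rightarrow> bool" where
  "inflection_point F p \<longleftrightarrow> p \<in> zero_locus F \<and>
     (\<exists>v\<in>p. v \<noteq> 0 \<and> intersection_mult p (tangent_form F v) F \<ge> 3)"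

definition conic :: "poly3 \<Rightarrow> bool" where
  "conic C \<longleftrightarrow> C \<noteq> 0 \<and> form 2 C"

text \<open>Uniqueness of the osculating conic is up to a constant factor of its equation.\<close>

definition osculating_conic :: "poly3 \<Rightarrow> (complex ^ 3) set \<Rightarrow> poly3 \<Rightarrow> bool" where
  "osculating_conic F p C \<longleftrightarrow> conic C \<and> intersection_mult p C F \<ge> 5 \<and>
     (\<forall>C'. conic C' \<and> intersection_mult p C' F \<ge> 5 \<longrightarrow> (\<exists>c. C' = PC c * C))"

definition sextactic_point :: "poly3 \<Rightarrow> (complex ^ 3) set \<Rightarrow> bool" where
  "sextactic_point F p \<longleftrightarrow> p \<in> zero_locus F \<and> \<not> inflection_point F p \<and>
     (\<exists>C. osculating_conic F p C \<and> intersection_mult p C F \<ge> 6)"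

section \<open>Line arrangements\<close>

definition is_line :: "(complex ^ 3) set set \<Rightarrow> bool" where
  "is_line l \<longleftrightarrow> (\<exists>L. L \<noteq> 0 \<and> form 1 L \<and> l = zero_locus L)"

definition lines_of :: "poly3 \<Rightarrow> (complex ^ 3) set set set" where
  "lines_of F = {l. is_line l \<and> l \<subseteq> zero_locus F}"

definition intersection_points :: "(complex ^ 3) set set set \<Rightarrow> (complex ^ 3) set set" where
  "intersection_points A = {p. \<exists>l\<in>A. \<exists>l'\<in>A. l \<noteq> l' \<and> p \<in> l \<and> p \<in> l'}"

text \<open>For \<open>m > 0\<close> the cardinality condition also forces the set of lines through \<open>p\<close> to be finite.\<close>

definition ordinary_point :: "(complex ^ 3) set set set \<Rightarrow> nat \<Rightarrow> (complex ^ 3) set \<Rightarrow> bool" where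
  "ordinary_point A m p \<longleftrightarrow> p \<in> proj_plane \<and> card {l \<in> A. p \<in> l} = m"

section \<open>The Fermat curve\<close>

definition primitive_root_of_unity :: "nat \<Rightarrow> complex \<Rightarrow> bool" where
  "primitive_root_of_unity n w \<longleftrightarrow> n > 0 \<and> w ^ n = 1 \<and> (\<forall>m. 0 < m \<and> m < n \<longrightarrow> w ^ m \<noteq> 1)"

definition fermat :: "nat \<Rightarrow> poly3" where
  "fermat d = PX ^ d + PY ^ d + PZ ^ d"

definition s_point :: "nat \<Rightarrow> complex \<Rightarrow> complex \<Rightarrow> nat \<Rightarrow> nat \<Rightarrow> (complex ^ 3) set" where
  "s_point d u \<zeta> j k = hpoint (\<zeta> ^ j) 1 (u powi (- int k) * complex_of_real (root d 2))"

definition s_cluster :: "nat \<Rightarrow> complex \<Rightarrow> complex \<Rightarrow> (complex ^ 3) set set" where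
  "s_cluster d u \<zeta> = {s_point d u \<zeta> j k | j k. j < d \<and> odd k \<and> 0 < k \<and> k < 2 * d}"

definition clusters :: "nat \<Rightarrow> complex \<Rightarrow> complex \<Rightarrow> (complex ^ 3) set set set" where
  "clusters d u \<zeta> = {permute_coords \<sigma> ` s_cluster d u \<zeta> | \<sigma>. bij \<sigma>}"

definition B_z :: "nat \<Rightarrow> poly3" where "B_z d = PX ^ d - PY ^ d"
definition M_x :: "nat \<Rightarrow> poly3" where "M_x d = PZ ^ d + 2 * PY ^ d"
definition N_y :: "nat \<Rightarrow> poly3" where "N_y d = PZ ^ d + 2 * PX ^ d"

end

theory Submission
  imports Defs "HOL-Computational_Algebra.Formal_Power_Series"
begin

text \<open>
  At a point \<open>(a:b:1)\<close> of the Fermat curve with \<open>a, b \<noteq> 0\<close> put \<open>A = a\<^sup>d\<close>, \<open>B = b\<^sup>d\<close> and \<open>e = 1/d\<close>. Since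
  \<open>A + B + 1 = 0\<close>, the curve is parametrized there by \<open>x = a (1 + B s)\<^sup>e\<close>, \<open>y = b (1 - A s)\<^sup>e\<close>, \<open>z = 1\<close>, and
  the intersection multiplicity with a curve \<open>G = 0\<close> is the order in \<open>s\<close> of the pulled back form \<open>G\<close>.
  In terms of linear forms that vanish to orders 0, 1 and 2, the conics with contact of order at least
  five are the multiples of a single one, and its coefficient of \<open>s\<^sup>5\<close> is a nonzero multiple of
  \<open>(e + 1) (e - 2) (2 e - 1) (A - B) (A - 1) (B - 1)\<close>. So the sextactic points are the points where two of
  the three \<open>d\<close>-th powers \<open>x\<^sup>d\<close>, \<open>y\<^sup>d\<close>, \<open>z\<^sup>d\<close> agree; the points with a vanishing coordinate are
  inflection points.
\<close>

section \<open>Evaluation of ternary polynomials\<close>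

text \<open>The multiplicity is defined as the dimension of a quotient of a ring of fractions, and
  its identification with an order of vanishing has two halves of different cost. For a lower bound,
  both forms vanish to order \<open>k\<close> along some arc through the point, and the powers of a
  function with a simple zero on the arc are independent modulo the ideal. For an upper bound,
  everything of high order must lie in the ideal, which needs the local ring modulo the curve to
  behave like a discrete valuation ring. Inflection points need the lower bound only, so there the
  arc is simply the tangent line. The parameter on the curve is chosen to make \<open>x^d\<close>
  and \<open>y^d\<close> affine in it: \<open>A (1 + B s) + B (1 - A s) + 1 = 0\<close>. All
  coefficients are then binomial coefficients times differences \<open>B^n - (-A)^n\<close>. Since
  \<open>B - (-A) = -1\<close>, these are symmetric polynomials in \<open>B\<close> and
  \<open>-A\<close>, so the whole computation runs in the sum \<open>B - A\<close> and the product
  \<open>-A B\<close>. The factor \<open>2 e - 1\<close> is zero for \<open>d = 2\<close>, where the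
  curve is its own osculating conic.\<close>

definition ring_morphism :: "('a::comm_ring_1 \<Rightarrow> 'b::comm_ring_1) \<Rightarrow> bool" where
  "ring_morphism h \<longleftrightarrow> h 0 = 0 \<and> h 1 = 1 \<and> (\<forall>a b. h (a + b) = h a + h b) \<and>
     (\<forall>a b. h (a * b) = h a * h b)"

text \<open>One evaluation step for nested polynomials: coefficients pass through a morphism, then
  one variable is substituted. Three iterations, one per variable, give
  \<open>fps_eval3\<close>.\<close>

lemma ring_morphism_poly_map_poly:
  assumes "ring_morphism h"
  shows "ring_morphism (\<lambda>p. poly (map_poly h p) x)"
proof -
  have h: "h 0 = 0" "h 1 = 1" "h (a + b) = h a + h b" "h (a * b) = h a * h b" for a b
    using assms by (auto simp: ring_morphism_def)
  let ?e = "\<lambda>p. poly (map_poly h p) x"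
  have pC: "?e (pCons a p) = h a + x * ?e p" for a p
    using h by (simp add: map_poly_pCons)
  have add: "?e (p + q) = ?e p + ?e q" for p q
    by (induction p q rule: poly_induct2) (simp_all add: pC h algebra_simps)
  have smult: "?e (smult a p) = h a * ?e p" for a p
    by (induction p) (simp_all add: pC h algebra_simps)
  have mult: "?e (p * q) = ?e p * ?e q" for p q
    by (induction p) (simp_all add: pC h smult add algebra_simps)
  show ?thesis
    unfolding ring_morphism_def using h add mult by (auto simp: map_poly_1)
qed

definition fps_eval3 :: "complex fps ^ 3 \<Rightarrow> poly3 \<Rightarrow> complex fps" where
  "fps_eval3 g P = poly (map_poly (\<lambda>q. poly (map_poly (\<lambda>r. poly (map_poly fps_const r) (g $ 1)) q) (g $ 2)) P) (g $ 3)"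

lemma ring_morphism_fps_eval3: "ring_morphism (fps_eval3 g)"
  unfolding fps_eval3_def
  by (intro ring_morphism_poly_map_poly) (simp add: ring_morphism_def)

lemma ring_morphism_eval3: "ring_morphism (\<lambda>P. eval3 P v)"
  by (simp add: ring_morphism_def eval3_def)

lemma ring_morphism_power: "ring_morphism h \<Longrightarrow> h (a ^ n) = h a ^ n"
  by (induction n) (auto simp: ring_morphism_def)

lemma ring_morphism_uminus: "ring_morphism h \<Longrightarrow> h (- a) = - h a"
  unfolding ring_morphism_def by (metis add.right_inverse minus_unique)

lemma ring_morphism_diff: "ring_morphism h \<Longrightarrow> h (a - b) = h a - h b"
  using ring_morphism_uminus[of h b] by (metis ring_morphism_def diff_conv_add_uminus)

lemma ring_morphism_numeral: "ring_morphism h \<Longrightarrow> h (numeral n) = numeral n"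
proof -
  assume h: "ring_morphism h"
  have "h (of_nat n) = of_nat n" for n
    by (induction n) (use h in \<open>auto simp: ring_morphism_def\<close>)
  from this[of "numeral n"] show ?thesis by simp
qed

lemma ring_morphismD:
  assumes "ring_morphism h"
  shows "h 0 = 0" "h 1 = 1" "h (a + b) = h a + h b" "h (a * b) = h a * h b" "h (a ^ n) = h a ^ n"
    "h (- a) = - h a" "h (a - b) = h a - h b" "h (numeral m) = numeral m"
  using assms ring_morphism_power[OF assms] ring_morphism_uminus[OF assms]
    ring_morphism_diff[OF assms] ring_morphism_numeral[OF assms]
  by (auto simp: ring_morphism_def)

lemmas eval3_hom [simp] = ring_morphismD[OF ring_morphism_eval3]
lemmas fps_eval3_hom [simp] = ring_morphismD[OF ring_morphism_fps_eval3]

lemma eval3_gens [simp]: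
  "eval3 (PC c) v = c" "eval3 PX v = v $ 1" "eval3 PY v = v $ 2" "eval3 PZ v = v $ 3"
  by (simp_all add: eval3_def PC_def PX_def PY_def PZ_def)

lemma fps_eval3_gens [simp]:
  "fps_eval3 g (PC c) = fps_const c" "fps_eval3 g PX = g $ 1" "fps_eval3 g PY = g $ 2"
  "fps_eval3 g PZ = g $ 3"
  by (simp_all add: fps_eval3_def PC_def PX_def PY_def PZ_def map_poly_pCons)

section \<open>Forms\<close>

lemma PC_simps [simp]: "PC 0 = 0" "PC 1 = 1" "PC (a + b) = PC a + PC b" "PC (a * b) = PC a * PC b"
  "PC (- a) = - PC a" "PC (a - b) = PC a - PC b"
  by (simp_all add: PC_def one_pCons)

lemma PC_power: "PC (a ^ n) = PC a ^ n"
  by (induction n) simp_all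

lemma monom_eq_PC: "monom (monom (monom c i) j) k = PC c * PX ^ i * PY ^ j * PZ ^ k"
proof -
  have "PC c * PX ^ i = [:[:monom c i:]:]"
    by (simp add: PC_def PX_def poly_const_pow monom_altdef)
  moreover have "[:[:q:]:] * PY ^ j = [:monom q j:]" for q
    by (simp add: PY_def poly_const_pow monom_altdef)
  moreover have "[:q:] * PZ ^ k = monom q k" for q
    by (simp add: PZ_def poly_const_pow monom_altdef)
  ultimately show ?thesis by simp
qed

lemma form_monomial: "form (i + j + k) (PC c * PX ^ i * PY ^ j * PZ ^ k)"
  unfolding monom_eq_PC[symmetric] form_def by simp

lemma form_zero [simp]: "form n 0"
  by (simp add: form_def)

lemma form_add: "form n P \<Longrightarrow> form n Q \<Longrightarrow> form n (P + Q)"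
  unfolding form_def coeff_add by (metis add.right_neutral)

lemma form_uminus: "form n P \<Longrightarrow> form n (- P)"
  by (simp add: form_def)

lemma form_diff: "form n P \<Longrightarrow> form n Q \<Longrightarrow> form n (P - Q)"
  using form_add[of n P "- Q"] form_uminus[of n Q] by simp

text \<open>A form is the sum of its monomials, all of total degree \<open>n\<close>, so closure
  under sums leaves only these to check. Later arguments thus avoid the triple coefficient
  sums.\<close>

lemma form_induct [consumes 1, case_names zero add monomial]:
  assumes "form n P" "S 0" "\<And>P Q. S P \<Longrightarrow> S Q \<Longrightarrow> S (P + Q)"
    and mon: "\<And>c i j k. i + j + k = n \<Longrightarrow> S (PC c * PX ^ i * PY ^ j * PZ ^ k)"
  shows "S P"
proof -
  have sum: "S (sum f I)" if "\<And>i. i \<in> I \<Longrightarrow> S (f i)" "finite I" for f and I :: "nat set"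
    using that(2,1) by (induction) (use assms in auto)
  have "S (\<Sum>k\<le>degree P. monom (coeff P k) k)"
  proof (intro sum)
    fix k
    have "monom (coeff P k) k = (\<Sum>j\<le>degree (coeff P k). \<Sum>i\<le>degree (coeff (coeff P k) j).
        monom (monom (monom (coeff (coeff (coeff P k) j) i) i) j) k)"
      by (subst (1) poly_as_sum_of_monoms[of "coeff P k", symmetric],
          subst (1) poly_as_sum_of_monoms[of "coeff (coeff P k) _", symmetric])
        (simp only: monom_sum)
    moreover have "S (monom (monom (monom (coeff (coeff (coeff P k) j) i) i) j) k)" for i j
    proof (cases "coeff (coeff (coeff P k) j) i = 0")
      case False
      then have "i + j + k = n" using assms(1) by (auto simp: form_def)
      then show ?thesis unfolding monom_eq_PC by (rule mon)
    qed (use assms(2) in simp)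
    ultimately show "S (monom (coeff P k) k)"
      by (auto intro!: sum)
  qed auto
  then show ?thesis by (simp add: poly_as_sum_of_monoms)
qed

lemma form_mult:
  assumes "form m P" "form n Q"
  shows "form (m + n) (P * Q)"
  using assms(1)
proof (induction rule: form_induct)
  case (monomial c i j k)
  show ?case using assms(2)
  proof (induction rule: form_induct)
    case (monomial c' i' j' k')
    have eq: "PC c * PX ^ i * PY ^ j * PZ ^ k * (PC c' * PX ^ i' * PY ^ j' * PZ ^ k') =
        PC (c * c') * PX ^ (i + i') * PY ^ (j + j') * PZ ^ (k + k')"
      by (simp add: power_add algebra_simps)
    have deg: "(i + i') + (j + j') + (k + k') = m + n"
      using monomial \<open>i + j + k = m\<close> by simp
    show ?case
      unfolding eq by (rule form_monomial[of "i + i'" "j + j'" "k + k'" "c * c'", unfolded deg])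
  qed (auto simp: distrib_left form_add)
qed (auto simp: distrib_right form_add)

lemma form_PC [simp]: "form 0 (PC c)" and form_one [simp]: "form 0 1"
  using form_monomial[of 0 0 0 c] form_monomial[of 0 0 0 1] by simp_all

lemma form_PC_mult: "form n P \<Longrightarrow> form n (PC c * P)"
  using form_mult[of 0 "PC c"] by simp

lemma form_PX [simp]: "form 1 PX" and form_PY [simp]: "form 1 PY" and form_PZ [simp]: "form 1 PZ"
  using form_monomial[of 1 0 0 1] form_monomial[of 0 1 0 1] form_monomial[of 0 0 1 1] by simp_all

lemma form_power: "form n P \<Longrightarrow> form (k * n) (P ^ k)"
  by (induction k) (auto intro: form_mult)

lemma form_power1: "form 1 P \<Longrightarrow> form n (P ^ n)"
  using form_power[of 1 P n] by simp

lemma eval3_scale: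
  assumes "form n P"
  shows "eval3 P (k *s v) = k ^ n * eval3 P v"
  using assms by (induction rule: form_induct)
    (auto simp: algebra_simps power_mult_distrib power_add)

lemma fps_eval3_nth_0:
  assumes "\<And>i. fps_nth (g $ i) 0 = v $ i" "form n P"
  shows "fps_nth (fps_eval3 g P) 0 = eval3 P v"
  using assms(2) by (induction rule: form_induct) (auto simp: assms(1) fps_power_zeroth)

lemma form_1_cases:
  assumes "form 1 P"
  obtains a b c where "P = PC a * PX + PC b * PY + PC c * PZ"
proof -
  have "\<exists>a b c. P = PC a * PX + PC b * PY + PC c * PZ"
    using assms
  proof (induction rule: form_induct)
    case zero
    have "(0::poly3) = PC 0 * PX + PC 0 * PY + PC 0 * PZ" by simp
    then show ?case by blast
  next
    case (add P Q)
    then obtain a b c a' b' c' where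
      "P = PC a * PX + PC b * PY + PC c * PZ" "Q = PC a' * PX + PC b' * PY + PC c' * PZ" by blast
    then have "P + Q = PC (a + a') * PX + PC (b + b') * PY + PC (c + c') * PZ"
      by (simp add: algebra_simps)
    then show ?case by blast
  next
    case (monomial c i j k)
    then have "i = 1 \<and> j = 0 \<and> k = 0 \<or> i = 0 \<and> j = 1 \<and> k = 0 \<or> i = 0 \<and> j = 0 \<and> k = 1"
      by linarith
    then have "PC c * PX ^ i * PY ^ j * PZ ^ k =
        PC (if i = 1 then c else 0) * PX + PC (if j = 1 then c else 0) * PY + PC (if k = 1 then c else 0) * PZ"
      by (elim disjE conjE) simp_all
    then show ?case by blast
  qed
  then show ?thesis using that by blast
qed

lemma form_2_cases:
  assumes "form 2 P"
  obtains a1 a2 a3 a4 a5 a6 where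
    "P = PC a1 * PX ^ 2 + PC a2 * PX * PY + PC a3 * PY ^ 2 + PC a4 * PX * PZ + PC a5 * PY * PZ + PC a6 * PZ ^ 2"
proof -
  define S where "S P a = (P = PC (a 1) * PX ^ 2 + PC (a 2) * PX * PY + PC (a 3) * PY ^ 2 +
    PC (a 4) * PX * PZ + PC (a 5) * PY * PZ + PC (a 6) * PZ ^ 2)" for P and a :: "nat \<Rightarrow> complex"
  have "\<exists>a. S P a"
    using assms
  proof (induction rule: form_induct)
    case zero
    have "S 0 (\<lambda>_. 0)" by (simp add: S_def)
    then show ?case by blast
  next
    case (add P Q)
    then obtain a b where "S P a" "S Q b" by (elim exE)
    then have "S (P + Q) (\<lambda>i. a i + b i)"
      unfolding S_def PC_simps distrib_right by (simp only: add_ac)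
    then show ?case by blast
  next
    case (monomial c i j k)
    then have "i = 2 \<and> j = 0 \<and> k = 0 \<or> i = 1 \<and> j = 1 \<and> k = 0 \<or> i = 0 \<and> j = 2 \<and> k = 0 \<or>
      i = 1 \<and> j = 0 \<and> k = 1 \<or> i = 0 \<and> j = 1 \<and> k = 1 \<or> i = 0 \<and> j = 0 \<and> k = 2"
      (is ?D)
    proof -
      have "i = 0 \<or> i = 1 \<or> i = 2" "j = 0 \<or> j = 1 \<or> j = 2"
        using monomial by linarith+
      then show ?D using monomial by (elim disjE) simp_all
    qed
    then obtain m :: nat where "S (PC c * PX ^ i * PY ^ j * PZ ^ k) ((\<lambda>_. 0)(m := c))"
    proof (elim disjE conjE)
      assume "i = 2" "j = 0" "k = 0" then show ?thesis using that[of 1] by (simp add: S_def)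
    next
      assume "i = 1" "j = 1" "k = 0" then show ?thesis using that[of 2] by (simp add: S_def)
    next
      assume "i = 0" "j = 2" "k = 0" then show ?thesis using that[of 3] by (simp add: S_def)
    next
      assume "i = 1" "j = 0" "k = 1" then show ?thesis using that[of 4] by (simp add: S_def)
    next
      assume "i = 0" "j = 1" "k = 1" then show ?thesis using that[of 5] by (simp add: S_def)
    next
      assume "i = 0" "j = 0" "k = 2" then show ?thesis using that[of 6] by (simp add: S_def)
    qed
    then show ?case by blast
  qed
  then obtain a where "S P a" by blast
  then show ?thesis using that unfolding S_def by blast
qed

section \<open>Intersection multiplicities along a branch\<close>

text \<open>Vanishing coefficients are used instead of a subdegree, so that the zero series, such as
  the pullback of \<open>F\<close> to its own curve, has order at least every
  \<open>k\<close>.\<close>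

definition order_ge :: "nat \<Rightarrow> 'a::zero fps \<Rightarrow> bool" where
  "order_ge k f \<longleftrightarrow> (\<forall>i<k. fps_nth f i = 0)"

lemma order_ge_add: "order_ge k f \<Longrightarrow> order_ge k g \<Longrightarrow> order_ge k (f + g)"
  for f g :: "'a::monoid_add fps"
  by (simp add: order_ge_def)

lemma order_ge_mult: "order_ge k f \<Longrightarrow> order_ge k (f * g)" "order_ge k f \<Longrightarrow> order_ge k (g * f)"
  for f g :: "'a::semiring_0 fps"
  by (auto simp: order_ge_def fps_mult_nth intro!: sum.neutral)

lemma order_ge_zero [simp]: "order_ge k 0"
  by (simp add: order_ge_def)

lemma order_ge_mono: "order_ge k f \<Longrightarrow> j \<le> k \<Longrightarrow> order_ge j f"
  by (simp add: order_ge_def)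

lemma order_ge_power:
  fixes f :: "'a::comm_ring_1 fps"
  assumes "fps_nth f 0 = 0"
  shows "order_ge k (f ^ k)"
  using startsby_zero_power_prefix[OF assms] by (simp add: order_ge_def)

text \<open>\<open>f\<close> has a simple zero, so \<open>f ^ i\<close> starts exactly in degree
  \<open>i\<close> and the system for the \<open>c i\<close> is triangular.\<close>

lemma power_combination_order_ge:
  fixes f :: "'a::idom fps"
  assumes "fps_nth f 0 = 0" "fps_nth f 1 \<noteq> 0"
    and "order_ge k (\<Sum>i<k. fps_const (c i) * f ^ i)"
  shows "\<forall>i<k. c i = 0"
proof (intro allI impI)
  fix i assume "i < k"
  then show "c i = 0"
  proof (induction i rule: less_induct)
    case (less m)
    have "(\<Sum>i<k. c i * fps_nth (f ^ i) m) = (\<Sum>i<k. if i = m then c m * fps_nth f 1 ^ m else 0)"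
    proof (intro sum.cong refl)
      fix i assume "i \<in> {..<k}"
      consider "i < m" | "i = m" | "m < i" by linarith
      then show "c i * fps_nth (f ^ i) m = (if i = m then c m * fps_nth f 1 ^ m else 0)"
        using less \<open>i \<in> {..<k}\<close> startsby_zero_power_prefix[OF assms(1)]
          startsby_zero_power_nth_same[OF assms(1)]
        by cases auto
    qed
    also have "\<dots> = c m * fps_nth f 1 ^ m"
      using less.prems by simp
    finally show ?case
      using assms(2,3) less.prems by (auto simp: order_ge_def fps_sum_nth)
  qed
qed

text \<open>Gaussian elimination, one equation per induction step. It serves to bound dimensions
  from above: among more than \<open>n\<close> elements, some nontrivial combination has its first
  \<open>n\<close> series coefficients equal to 0.\<close>

lemma underdetermined_system:
  fixes f :: "nat \<Rightarrow> 'b \<Rightarrow> 'a::field"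
  assumes "finite B" "n < card B"
  shows "\<exists>c. (\<exists>b\<in>B. c b \<noteq> 0) \<and> (\<forall>i<n. (\<Sum>b\<in>B. c b * f i b) = 0)"
  using assms
proof (induction n arbitrary: f B)
  case 0
  then have "B \<noteq> {}" by auto
  then show ?case by (intro exI[of _ "\<lambda>_. 1"]) auto
next
  case (Suc n)
  show ?case
  proof (cases "\<forall>b\<in>B. f n b = 0")
    case True
    obtain c where "\<exists>b\<in>B. c b \<noteq> 0" "\<forall>i<n. (\<Sum>b\<in>B. c b * f i b) = 0"
      using Suc.IH[of B f] Suc.prems by auto
    then show ?thesis using True by (intro exI[of _ c]) (auto simp: less_Suc_eq)
  next
    case False
    then obtain b0 where b0: "b0 \<in> B" "f n b0 \<noteq> 0" by auto
    \<comment> \<open>Equation \<open>n\<close> is solved for the unknown at the pivot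
      \<open>b0\<close> and eliminated from the others; the value of \<open>c'\<close> at
      \<open>b0\<close> restores it.\<close>
    define r where "r b = f n b / f n b0" for b
    define B' where "B' = B - {b0}"
    have B': "finite B'" "n < card B'" "B = insert b0 B'" "b0 \<notin> B'"
      using Suc.prems b0 by (auto simp: B'_def)
    obtain c where c: "\<exists>b\<in>B'. c b \<noteq> 0" "\<And>i. i < n \<Longrightarrow> (\<Sum>b\<in>B'. c b * (f i b - r b * f i b0)) = 0"
      using Suc.IH[OF B'(1,2), of "\<lambda>i b. f i b - r b * f i b0"] by auto
    define c' where "c' = c(b0 := - (\<Sum>b\<in>B'. c b * r b))"
    have eq: "(\<Sum>b\<in>B. c' b * f i b) = (\<Sum>b\<in>B'. c b * (f i b - r b * f i b0))" for i
    proof -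
      have "(\<Sum>b\<in>B. c' b * f i b) = c' b0 * f i b0 + (\<Sum>b\<in>B'. c' b * f i b)"
        using B' by simp
      also have "(\<Sum>b\<in>B'. c' b * f i b) = (\<Sum>b\<in>B'. c b * f i b)"
        using B'(4) by (intro sum.cong) (auto simp: c'_def)
      finally show ?thesis
        by (simp add: c'_def right_diff_distrib sum_subtractf sum_distrib_right mult.assoc)
    qed
    have "f n b - r b * f n b0 = 0" for b
      unfolding r_def times_divide_eq_left nonzero_mult_div_cancel_right[OF b0(2)] by (rule diff_self)
    then have "(\<Sum>b\<in>B. c' b * f i b) = 0" if "i < Suc n" for i
      unfolding eq using c(2) that by (cases "i = n") (simp_all only: mult_zero_right sum.neutral_const less_Suc_eq simp_thms)
    moreover have "\<exists>b\<in>B. c' b \<noteq> 0"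
      using c(1) B' by (auto simp: c'_def)
    ultimately show ?thesis by blast
  qed
qed

text \<open>A formal arc through \<open>v\<close>, not tied to a curve. It is instantiated by a
  parametrization of the Fermat curve and, at points with a vanishing coordinate, by an arc along
  the tangent line.\<close>

locale branch =
  fixes v :: "complex ^ 3" and g :: "complex fps ^ 3"
  assumes nth_0: "\<And>i. fps_nth (g $ i) 0 = v $ i"
begin

abbreviation "p \<equiv> vec.span {v}"

lemma nonvanishing_iff: "form n b \<Longrightarrow> nonvanishing_at p b \<longleftrightarrow> eval3 b v \<noteq> 0"
  unfolding nonvanishing_at_def
  using vec.span_base[of v "{v}"] by (auto simp: vec.span_singleton eval3_scale)

lemma local_ring_iff:
  "x \<in> local_ring p \<longleftrightarrow> (\<exists>a b n. x = Fract a b \<and> form n a \<and> form n b \<and> eval3 b v \<noteq> 0)"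
  unfolding local_ring_def using nonvanishing_iff by blast

lemma Fract_in_local_ring: "form n a \<Longrightarrow> form n b \<Longrightarrow> eval3 b v \<noteq> 0 \<Longrightarrow> Fract a b \<in> local_ring p"
  using local_ring_iff by blast

lemma local_ringE:
  assumes "x \<in> local_ring p"
  obtains a b n where "x = Fract a b" "form n a" "form n b" "eval3 b v \<noteq> 0" "b \<noteq> 0"
  using assms that unfolding local_ring_iff by fastforce

lemma nonzero: "eval3 b v \<noteq> 0 \<Longrightarrow> b \<noteq> 0"
  by auto

lemma const_in_local_ring: "Fract (PC c) 1 \<in> local_ring p"
  by (rule Fract_in_local_ring[of 0]) auto

lemma zero_in_local_ring: "0 \<in> local_ring p" and one_in_local_ring: "1 \<in> local_ring p"
  using const_in_local_ring[of 0] const_in_local_ring[of 1]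
  by (simp_all add: Zero_fract_def One_fract_def)

lemma add_in_local_ring:
  assumes "x \<in> local_ring p" "y \<in> local_ring p" shows "x + y \<in> local_ring p"
proof -
  obtain a b n where x: "x = Fract a b" "form n a" "form n b" "eval3 b v \<noteq> 0" "b \<noteq> 0"
    using assms(1) by (rule local_ringE)
  obtain a' b' n' where y: "y = Fract a' b'" "form n' a'" "form n' b'" "eval3 b' v \<noteq> 0" "b' \<noteq> 0"
    using assms(2) by (rule local_ringE)
  have "form (n + n') (a * b' + a' * b)"
    using form_mult[of n a n' b'] form_mult[of n' a' n b] x y by (simp add: add.commute form_add)
  then show ?thesis
    using x y by (auto intro!: Fract_in_local_ring form_mult)
qed

lemma mult_in_local_ring:
  assumes "x \<in> local_ring p" "y \<in> local_ring p" shows "x * y \<in> local_ring p"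
proof -
  obtain a b n where x: "x = Fract a b" "form n a" "form n b" "eval3 b v \<noteq> 0" "b \<noteq> 0"
    using assms(1) by (rule local_ringE)
  obtain a' b' n' where y: "y = Fract a' b'" "form n' a'" "form n' b'" "eval3 b' v \<noteq> 0" "b' \<noteq> 0"
    using assms(2) by (rule local_ringE)
  show ?thesis
    using x y by (auto intro!: Fract_in_local_ring form_mult)
qed

lemma uminus_in_local_ring: "x \<in> local_ring p \<Longrightarrow> - x \<in> local_ring p"
  using mult_in_local_ring[OF const_in_local_ring[of "-1"], of x]
  by (simp flip: minus_fract One_fract_def)

lemma power_in_local_ring: "x \<in> local_ring p \<Longrightarrow> x ^ n \<in> local_ring p"
  by (induction n) (auto intro: one_in_local_ring mult_in_local_ring)

lemma sum_in_local_ring: "(\<And>i. i \<in> I \<Longrightarrow> f i \<in> local_ring p) \<Longrightarrow> sum f I \<in> local_ring p"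
  by (induction I rule: infinite_finite_induct) (auto intro: zero_in_local_ring add_in_local_ring)

section \<open>Power series expansion of local ring elements along a branch\<close>

definition expansion :: "poly3 fract \<Rightarrow> complex fps" where
  "expansion x = (SOME f. \<exists>a b n. x = Fract a b \<and> form n a \<and> form n b \<and> eval3 b v \<noteq> 0 \<and>
     f = fps_eval3 g a * inverse (fps_eval3 g b))"

lemma eval_nth_0: "form n b \<Longrightarrow> fps_nth (fps_eval3 g b) 0 = eval3 b v"
  by (rule fps_eval3_nth_0[OF nth_0])

text \<open>Independence of the chosen fraction: cross-multiplication yields a polynomial identity,
  which substitution preserves, and denominators become units because their constant terms are the
  nonzero values at \<open>v\<close>.\<close>

lemma expansion_Fract:
  assumes "form n a" "form n b" "eval3 b v \<noteq> 0"
  shows "expansion (Fract a b) = fps_eval3 g a * inverse (fps_eval3 g b)"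
proof -
  have "f = fps_eval3 g a * inverse (fps_eval3 g b)"
    if f: "\<exists>a' b' n'. Fract a b = Fract a' b' \<and> form n' a' \<and> form n' b' \<and> eval3 b' v \<noteq> 0 \<and>
     f = fps_eval3 g a' * inverse (fps_eval3 g b')" for f
  proof -
    obtain a' b' n' where *: "Fract a b = Fract a' b'" "form n' a'" "form n' b'" "eval3 b' v \<noteq> 0"
      "f = fps_eval3 g a' * inverse (fps_eval3 g b')" using f by blast
    have "a * b' = a' * b"
      using *(1) nonzero[OF assms(3)] nonzero[OF *(4)] by (simp add: eq_fract)
    then have eq: "fps_eval3 g a * fps_eval3 g b' = fps_eval3 g a' * fps_eval3 g b"
      by (metis fps_eval3_hom(4))
    have i: "fps_eval3 g b * inverse (fps_eval3 g b) = 1" "fps_eval3 g b' * inverse (fps_eval3 g b') = 1"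
      using * assms eval_nth_0 by (auto intro!: inverse_mult_eq_1')
    have "fps_eval3 g a * inverse (fps_eval3 g b)
        = fps_eval3 g a * inverse (fps_eval3 g b) * (fps_eval3 g b' * inverse (fps_eval3 g b'))"
      using i by simp
    also have "\<dots> = (fps_eval3 g a * fps_eval3 g b') * inverse (fps_eval3 g b) * inverse (fps_eval3 g b')"
      by (simp only: ac_simps)
    also have "\<dots> = fps_eval3 g a' * inverse (fps_eval3 g b') * (fps_eval3 g b * inverse (fps_eval3 g b))"
      unfolding eq by (simp only: ac_simps)
    finally show ?thesis using i *(5) by simp
  qed
  moreover have "\<exists>f a' b' n'. Fract a b = Fract a' b' \<and> form n' a' \<and> form n' b' \<and> eval3 b' v \<noteq> 0 \<and>
     f = fps_eval3 g a' * inverse (fps_eval3 g b')"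
    using assms by blast
  ultimately show ?thesis
    unfolding expansion_def by (rule someI2_ex[rotated])
qed

lemma expansion_const [simp]: "expansion (Fract (PC c) 1) = fps_const c"
  by (subst expansion_Fract[of 0]) auto

lemma expansion_zero [simp]: "expansion 0 = 0" and expansion_one [simp]: "expansion 1 = 1"
  using expansion_const[of 0] expansion_const[of 1] by (simp_all add: Zero_fract_def One_fract_def)

lemma expansion_add:
  assumes "x \<in> local_ring p" "y \<in> local_ring p"
  shows "expansion (x + y) = expansion x + expansion y"
proof -
  obtain a b n where x: "x = Fract a b" "form n a" "form n b" "eval3 b v \<noteq> 0" "b \<noteq> 0"
    using assms(1) by (rule local_ringE)
  obtain a' b' n' where y: "y = Fract a' b'" "form n' a'" "form n' b'" "eval3 b' v \<noteq> 0" "b' \<noteq> 0"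
    using assms(2) by (rule local_ringE)
  have f: "form (n + n') (a * b' + a' * b)"
    using form_mult[of n a n' b'] form_mult[of n' a' n b] x y by (simp add: add.commute form_add)
  have i: "fps_eval3 g b * inverse (fps_eval3 g b) = 1" "fps_eval3 g b' * inverse (fps_eval3 g b') = 1"
    using x y eval_nth_0 by (auto intro!: inverse_mult_eq_1')
  have "expansion (x + y) = expansion (Fract (a * b' + a' * b) (b * b'))"
    using x y by simp
  also have "\<dots> = (fps_eval3 g a * fps_eval3 g b' + fps_eval3 g a' * fps_eval3 g b) *
      (inverse (fps_eval3 g b) * inverse (fps_eval3 g b'))"
    using x y by (subst expansion_Fract[OF f]) (auto intro!: form_mult simp: fps_inverse_mult)
  also have "\<dots> = fps_eval3 g a * inverse (fps_eval3 g b) * (fps_eval3 g b' * inverse (fps_eval3 g b')) +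
     fps_eval3 g a' * inverse (fps_eval3 g b') * (fps_eval3 g b * inverse (fps_eval3 g b))"
    unfolding distrib_right by (simp only: ac_simps)
  finally show ?thesis
    using x y i by (simp add: expansion_Fract)
qed

lemma expansion_mult:
  assumes "x \<in> local_ring p" "y \<in> local_ring p"
  shows "expansion (x * y) = expansion x * expansion y"
proof -
  obtain a b n where x: "x = Fract a b" "form n a" "form n b" "eval3 b v \<noteq> 0" "b \<noteq> 0"
    using assms(1) by (rule local_ringE)
  obtain a' b' n' where y: "y = Fract a' b'" "form n' a'" "form n' b'" "eval3 b' v \<noteq> 0" "b' \<noteq> 0"
    using assms(2) by (rule local_ringE)
  have "expansion (x * y) = fps_eval3 g (a * a') * inverse (fps_eval3 g (b * b'))"
    unfolding x(1) y(1) mult_fract using x y by (intro expansion_Fract[of "n + n'"]) (auto intro: form_mult)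
  then show ?thesis
    using x y by (simp add: expansion_Fract fps_inverse_mult ac_simps)
qed

lemma expansion_sum:
  "(\<And>i. i \<in> I \<Longrightarrow> f i \<in> local_ring p) \<Longrightarrow> expansion (sum f I) = (\<Sum>i\<in>I. expansion (f i))"
  by (induction I rule: infinite_finite_induct) (auto simp: expansion_add sum_in_local_ring)

lemma expansion_power: "x \<in> local_ring p \<Longrightarrow> expansion (x ^ n) = expansion x ^ n"
  by (induction n) (auto simp: expansion_mult power_in_local_ring)

lemma local_equationsE:
  assumes "f \<in> local_equations p F"
  obtains b n where "f = Fract F b" "form n F" "form n b" "eval3 b v \<noteq> 0"
  using assms unfolding local_equations_def using nonvanishing_iff by blast

lemma expansion_local_ideal:
  assumes "order_ge k (fps_eval3 g F)" "order_ge k (fps_eval3 g G)" "x \<in> local_ideal p F G"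
  shows "order_ge k (expansion x)"
proof -
  have eqn: "f \<in> local_ring p \<and> order_ge k (expansion f)"
    if "f \<in> local_equations p H" "order_ge k (fps_eval3 g H)" for f H
    using that(1) by (rule local_equationsE)
      (use that(2) in \<open>auto simp: expansion_Fract intro: Fract_in_local_ring order_ge_mult\<close>)
  obtain r s f h where "x = r * f + s * h" "r \<in> local_ring p" "s \<in> local_ring p"
      "f \<in> local_equations p F" "h \<in> local_equations p G"
    using assms(3) unfolding local_ideal_def by blast
  with eqn[of f F] eqn[of h G] assms(1,2) show ?thesis
    by (auto simp: expansion_add expansion_mult mult_in_local_ring intro!: order_ge_add order_ge_mult)
qed

section \<open>Lower and upper bounds on the intersection multiplicity\<close>

lemma expansion_combination:
  assumes "B \<subseteq> local_ring p"
  shows "expansion (\<Sum>b\<in>B. Fract (PC (c b)) 1 * b) = (\<Sum>b\<in>B. fps_const (c b) * expansion b)"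
  using assms by (subst expansion_sum)
    (auto intro!: sum.cong simp: expansion_mult mult_in_local_ring const_in_local_ring subset_iff)

text \<open>\<open>T / M\<close> has a simple zero along the arc. Its powers with exponents below
  \<open>k\<close> have distinct orders below \<open>k\<close>, whereas elements of the ideal have
  order at least \<open>k\<close>.\<close>

lemma intersection_mult_ge:
  assumes "order_ge k (fps_eval3 g F)" "order_ge k (fps_eval3 g G)"
    and T: "form 1 T" "eval3 T v = 0" "fps_nth (fps_eval3 g T) 1 \<noteq> 0"
    and M: "form 1 M" "eval3 M v \<noteq> 0"
  shows "intersection_mult p F G \<ge> enat k"
proof -
  define t where "t = Fract T M"
  have t: "t \<in> local_ring p"
    unfolding t_def using T M by (intro Fract_in_local_ring)
  define e where "e = expansion t"
  have e_eq: "e = fps_eval3 g T * inverse (fps_eval3 g M)"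
    unfolding e_def t_def using T M by (intro expansion_Fract)
  have e: "fps_nth e 0 = 0" "fps_nth e 1 \<noteq> 0"
    using T M eval_nth_0[OF T(1)] eval_nth_0[OF M(1)] by (auto simp: e_eq)
  \<comment> \<open>\<open>quotient_dim\<close> counts the elements of a set, so distinct exponents
    must be shown to give distinct powers.\<close>
  have inj: "inj (\<lambda>i::nat. t ^ i)"
  proof (rule injI)
    fix i j :: nat assume "t ^ i = t ^ j"
    then have "expansion (t ^ i) = expansion (t ^ j)" by simp
    then have eij: "e ^ i = e ^ j" by (simp add: expansion_power t e_def)
    have "i \<ge> j" if "e ^ i = e ^ j" for i j :: nat
      using startsby_zero_power_prefix[OF e(1), of j] startsby_zero_power_nth_same[OF e(1), of i] that e(2)
      by (metis not_le power_not_zero)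
    then show "i = j" using eij by (metis le_antisym)
  qed
  define B where "B = (\<lambda>i. t ^ i) ` {..<k}"
  have B: "finite B" "B \<subseteq> local_ring p" "card B = k"
    unfolding B_def using t inj by (auto simp: power_in_local_ring card_image inj_on_def)
  have "\<forall>b\<in>B. c b = 0" if "(\<Sum>b\<in>B. Fract (PC (c b)) 1 * b) \<in> local_ideal p F G" for c
  proof -
    have "order_ge k (\<Sum>b\<in>B. fps_const (c b) * expansion b)"
      using expansion_local_ideal[OF assms(1,2) that] expansion_combination[OF B(2)] by simp
    also have "(\<Sum>b\<in>B. fps_const (c b) * expansion b) = (\<Sum>i<k. fps_const (c (t ^ i)) * e ^ i)"
      unfolding B_def using inj
      by (subst sum.reindex) (auto simp: inj_on_def expansion_power t e_def)
    finally show ?thesis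
      using power_combination_order_ge[OF e, of k "\<lambda>i. c (t ^ i)"] by (auto simp: B_def)
  qed
  then show ?thesis
    unfolding intersection_mult_def quotient_dim_def using B by (intro SUP_upper2[of B]) auto
qed

text \<open>Under the hypothesis, the first \<open>n\<close> coefficients of the expansion determine
  an element modulo the ideal, so more than \<open>n\<close> elements cannot be independent.\<close>

lemma intersection_mult_le:
  assumes ideal: "\<And>x. x \<in> local_ring p \<Longrightarrow> order_ge n (expansion x) \<Longrightarrow> x \<in> local_ideal p F G"
  shows "intersection_mult p F G \<le> enat n"
  unfolding intersection_mult_def quotient_dim_def
proof (rule SUP_least)
  fix B :: "poly3 fract set"
  assume "B \<in> {B. finite B \<and> B \<subseteq> local_ring p \<and>
      (\<forall>c. (\<Sum>b\<in>B. Fract (PC (c b)) 1 * b) \<in> local_ideal p F G \<longrightarrow> (\<forall>b\<in>B. c b = 0))}"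
  then have B: "finite B" "B \<subseteq> local_ring p"
    "\<And>c. (\<Sum>b\<in>B. Fract (PC (c b)) 1 * b) \<in> local_ideal p F G \<Longrightarrow> (\<forall>b\<in>B. c b = 0)" by auto
  have "card B \<le> n"
  proof (rule ccontr)
    assume "\<not> card B \<le> n"
    then obtain c where c: "\<exists>b\<in>B. c b \<noteq> 0" "\<forall>i<n. (\<Sum>b\<in>B. c b * fps_nth (expansion b) i) = 0"
      using underdetermined_system[OF B(1), of n "\<lambda>i b. fps_nth (expansion b) i"] by (auto simp: not_le)
    have "(\<Sum>b\<in>B. Fract (PC (c b)) 1 * b) \<in> local_ring p"
      using B(2) by (auto intro!: sum_in_local_ring mult_in_local_ring const_in_local_ring)
    moreover have "order_ge n (expansion (\<Sum>b\<in>B. Fract (PC (c b)) 1 * b))"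
      using c(2) unfolding expansion_combination[OF B(2)] by (simp add: order_ge_def fps_sum_nth)
    ultimately show False using ideal B(3) c(1) by blast
  qed
  then show "enat (card B) \<le> enat n" by simp
qed

end

section \<open>The Fermat curve at a point off the coordinate triangle\<close>

definition binomial_series :: "complex \<Rightarrow> complex \<Rightarrow> complex fps" where
  "binomial_series e c = Abs_fps (\<lambda>n. (e gchoose n) * c ^ n)"

lemma binomial_series_nth [simp]: "fps_nth (binomial_series e c) n = (e gchoose n) * c ^ n"
  by (simp add: binomial_series_def)

text \<open>The series is \<open>(1 + c X)^e\<close>, the binomial series composed with
  \<open>c X\<close>, so the \<open>n\<close> exponents \<open>1 / n\<close> add up to 1.\<close>

lemma binomial_series_power:
  assumes "n > 0"
  shows "binomial_series (1 / of_nat n) c ^ n = 1 + fps_const c * fps_X"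
proof -
  have eq: "binomial_series e c = fps_binomial e oo (fps_const c * fps_X)" for e
    unfolding fps_compose_linear by (simp add: fps_eq_iff mult.commute)
  have "binomial_series (1 / of_nat n) c ^ n = (fps_binomial (1 / of_nat n) ^ n) oo (fps_const c * fps_X)"
    unfolding eq by (rule fps_compose_power) simp
  also have "\<dots> = (1 + fps_X) oo (fps_const c * fps_X)"
    using assms by (simp add: fps_binomial_power fps_binomial_1)
  finally show ?thesis
    by (simp add: fps_compose_add_distrib)
qed

lemma form_fermat: "form d (fermat d)"
  unfolding fermat_def by (intro form_add form_power1 form_PX form_PY form_PZ)

locale fermat_point =
  fixes d :: nat and a b :: complex
  assumes d: "d > 1" and a: "a \<noteq> 0" and b: "b \<noteq> 0" and on_curve: "a ^ d + b ^ d + 1 = 0"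
begin

definition curve_branch :: "complex fps ^ 3" where
  "curve_branch = vector [fps_const a * binomial_series (1 / of_nat d) (b ^ d),
     fps_const b * binomial_series (1 / of_nat d) (- (a ^ d)), 1]"

sublocale branch "vector [a, b, 1]" curve_branch
proof
  show "fps_nth (curve_branch $ i) 0 = vector [a, b, 1] $ i" for i
    using exhaust_3[of i] by (auto simp: curve_branch_def)
qed

abbreviation "F \<equiv> fermat d"

text \<open>The power \<open>d\<close> undoes the exponent \<open>1 / d\<close>: the pullbacks of
  \<open>PX ^ d\<close> and \<open>PY ^ d\<close> are affine in the parameter, with opposite
  slopes.\<close>

lemma eval_F [simp]: "fps_eval3 curve_branch F = 0"
proof -
  have "fps_eval3 curve_branch F = fps_const (a ^ d) * (1 + fps_const (b ^ d) * fps_X) +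
      fps_const (b ^ d) * (1 + fps_const (- (a ^ d)) * fps_X) + 1"
    unfolding fermat_def fps_eval3_hom fps_eval3_gens
    using d by (simp add: curve_branch_def power_mult_distrib binomial_series_power fps_const_power
        flip: fps_const_power)
  also have "\<dots> = fps_const (a ^ d + b ^ d + 1)"
    by (simp add: fps_eq_iff algebra_simps)
  finally show ?thesis using on_curve by simp
qed

definition "X = Fract PX PZ"
definition "Y = Fract PY PZ"
definition "t = Fract (PX - PC a * PZ) PZ"
definition "\<phi> = Fract F (PZ ^ d)"

lemma PZ_nz [simp]: "PZ \<noteq> 0" "eval3 PZ (vector [a, b, 1]) = 1"
  by (simp add: PZ_def) simp

lemma form_t: "form 1 (PX - PC a * PZ)"
  by (intro form_diff form_PX form_PC_mult form_PZ)

lemma in_ring: "X \<in> local_ring p" "Y \<in> local_ring p" "t \<in> local_ring p" "\<phi> \<in> local_ring p"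
  unfolding X_def Y_def t_def \<phi>_def
  by (auto intro!: Fract_in_local_ring form_PX form_PY form_PZ form_t form_fermat form_power1)

lemma curve_branch_3 [simp]: "curve_branch $ 3 = 1"
  by (simp add: curve_branch_def)

lemma expansions:
  "expansion X = fps_const a * binomial_series (1 / of_nat d) (b ^ d)"
  "expansion Y = fps_const b * binomial_series (1 / of_nat d) (- (a ^ d))"
  "expansion t = fps_eval3 curve_branch (PX - PC a * PZ)"
  "expansion \<phi> = 0"
proof -
  show "expansion X = fps_const a * binomial_series (1 / of_nat d) (b ^ d)"
    unfolding X_def by (subst expansion_Fract[OF form_PX form_PZ]) (simp_all add: curve_branch_def)
  show "expansion Y = fps_const b * binomial_series (1 / of_nat d) (- (a ^ d))"
    unfolding Y_def by (subst expansion_Fract[OF form_PY form_PZ]) (simp_all add: curve_branch_def)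
  show "expansion t = fps_eval3 curve_branch (PX - PC a * PZ)"
    unfolding t_def by (subst expansion_Fract[OF form_t form_PZ]) (simp_all add: curve_branch_def)
  show "expansion \<phi> = 0"
    unfolding \<phi>_def by (subst expansion_Fract[OF form_fermat form_power1[OF form_PZ]]) simp_all
qed

text \<open>The linear coefficient is \<open>a * b ^ d / d\<close>, nonzero because the point is off
  the coordinate triangle.\<close>

lemma t_nth: "fps_nth (expansion t) 0 = 0" "fps_nth (expansion t) 1 \<noteq> 0"
  unfolding expansions using a b d by (simp_all add: curve_branch_def)

section \<open>The local ring modulo the curve, with uniformizer \<open>t\<close>\<close>

lemma unit_in_local_ring:
  assumes "x \<in> local_ring p" "fps_nth (expansion x) 0 \<noteq> 0"
  obtains y where "y \<in> local_ring p" "y * x = 1"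
proof -
  obtain m c n where x: "x = Fract m c" "form n m" "form n c" "eval3 c (vector [a, b, 1]) \<noteq> 0" "c \<noteq> 0"
    using assms(1) by (rule local_ringE)
  then have m: "eval3 m (vector [a, b, 1]) \<noteq> 0"
    using assms(2) eval_nth_0[OF x(2)] by (auto simp: expansion_Fract)
  then have "m \<noteq> 0" by auto
  then show ?thesis
    using that[of "Fract c m"] x m by (auto simp: Fract_in_local_ring One_fract_def eq_fract)
qed

text \<open>The elements whose residue class modulo \<open>(t, \<phi>)\<close> is a constant; by
  \<open>in_residual\<close> these are all elements of the local ring.\<close>

definition "residual = {x. \<exists>c r s. r \<in> local_ring p \<and> s \<in> local_ring p \<and>
  x = Fract (PC c) 1 + r * t + s * \<phi>}"

lemma residualI: "r \<in> local_ring p \<Longrightarrow> s \<in> local_ring p \<Longrightarrow> Fract (PC c) 1 + r * t + s * \<phi> \<in> residual"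
  unfolding residual_def by blast

lemma const_residual: "Fract (PC c) 1 \<in> residual"
  using residualI[OF zero_in_local_ring zero_in_local_ring] by simp

lemma Fract_PC_add: "Fract (PC (c + c')) 1 = Fract (PC c) 1 + Fract (PC c') 1"
  by simp

lemma add_residual:
  assumes "x \<in> residual" "y \<in> residual" shows "x + y \<in> residual"
proof -
  obtain c r s where x: "r \<in> local_ring p" "s \<in> local_ring p" "x = Fract (PC c) 1 + r * t + s * \<phi>"
    using assms(1) unfolding residual_def by blast
  obtain c' r' s' where y: "r' \<in> local_ring p" "s' \<in> local_ring p" "y = Fract (PC c') 1 + r' * t + s' * \<phi>"
    using assms(2) unfolding residual_def by blast
  have "x + y = Fract (PC (c + c')) 1 + (r + r') * t + (s + s') * \<phi>"
    unfolding x(3) y(3) Fract_PC_add distrib_right by (simp only: ac_simps)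
  then show ?thesis using x y by (metis residualI add_in_local_ring)
qed

lemma residual_subset: "residual \<subseteq> local_ring p"
  unfolding residual_def
  by (auto intro!: add_in_local_ring mult_in_local_ring const_in_local_ring in_ring)

lemma mult_residual:
  assumes "x \<in> residual" "y \<in> residual" shows "x * y \<in> residual"
proof -
  obtain c r s where x: "r \<in> local_ring p" "s \<in> local_ring p" "x = Fract (PC c) 1 + r * t + s * \<phi>"
    using assms(1) unfolding residual_def by blast
  obtain c' r' s' where y: "r' \<in> local_ring p" "s' \<in> local_ring p" "y = Fract (PC c') 1 + r' * t + s' * \<phi>"
    using assms(2) unfolding residual_def by blast
  have [simp]: "Fract (PC (c * c')) 1 = Fract (PC c) 1 * Fract (PC c') 1" by simp
  \<comment> \<open>\<open>x\<close> is expanded first, and \<open>y\<close> only in the term with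
    the constant \<open>c\<close>; every other term is already a multiple of \<open>t\<close> or
    \<open>\<phi>\<close> with \<open>y\<close> kept whole.\<close>
  have eq: "x * y = Fract (PC (c * c')) 1 + (Fract (PC c) 1 * r' + r * y) * t + (Fract (PC c) 1 * s' + s * y) * \<phi>"
    unfolding x(3) \<open>Fract (PC (c * c')) 1 = _\<close> unfolding distrib_right
    by (subst y(3)) (simp only: distrib_left distrib_right ac_simps)
  have "y \<in> local_ring p" using assms residual_subset by blast
  then show ?thesis
    unfolding eq using x(1,2) y(1,2)
    by (intro residualI add_in_local_ring mult_in_local_ring const_in_local_ring)
qed

lemma power_residual: "x \<in> residual \<Longrightarrow> x ^ n \<in> residual"
  using const_residual[of 1] by (induction n) (auto intro: mult_residual simp flip: One_fract_def)

lemma X_residual: "X \<in> residual" and X_minus: "X - Fract (PC a) 1 = t"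
proof -
  show t: "X - Fract (PC a) 1 = t"
    by (simp add: X_def t_def)
  then have "X = Fract (PC a) 1 + 1 * t + 0 * \<phi>"
    by (simp add: algebra_simps)
  then show "X \<in> residual"
    by (metis residualI one_in_local_ring zero_in_local_ring)
qed

lemma Fract_power: "Fract x y ^ n = Fract (x ^ n) (y ^ n)" for x y :: "'x::idom"
  by (induction n) (simp_all add: One_fract_def)

text \<open>Modulo \<open>\<phi>\<close>, \<open>X\<^sup>d - a\<^sup>d\<close> and \<open>Y\<^sup>d - b\<^sup>d\<close> are opposite, and the second is \<open>Y - b\<close> times a unit.
  Hence \<open>t = X - a\<close> is a uniformizer.\<close>

lemma Y_residual: "Y \<in> residual"
proof -
  let ?a = "Fract (PC a) 1" and ?b = "Fract (PC b) 1"
  have "Fract (PC (a ^ d)) 1 + Fract (PC (b ^ d)) 1 + 1 = Fract (PC (a ^ d + b ^ d + 1)) 1"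
    unfolding One_fract_def by simp
  then have "Fract (PC (a ^ d)) 1 + Fract (PC (b ^ d)) 1 + 1 = 0"
    using on_curve by (simp add: Zero_fract_def del: PC_simps(3))
  then have ab: "?a ^ d + ?b ^ d + 1 = 0"
    by (simp add: Fract_power PC_power)
  have "\<phi> = X ^ d + Y ^ d + 1"
    unfolding \<phi>_def X_def Y_def fermat_def One_fract_def Fract_power
    by (simp add: eq_fract algebra_simps)
  then have phi: "\<phi> = (X ^ d - ?a ^ d) + (Y ^ d - ?b ^ d)"
    using ab by (simp add: algebra_simps)
  define U where "U = (\<Sum>i<d. ?a ^ (d - Suc i) * X ^ i)"
  define V where "V = (\<Sum>i<d. ?b ^ (d - Suc i) * Y ^ i)"
  have UV: "U \<in> local_ring p" "V \<in> local_ring p"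
    unfolding U_def V_def
    by (intro sum_in_local_ring mult_in_local_ring power_in_local_ring const_in_local_ring in_ring)+
  have "X ^ d - ?a ^ d = t * U" "Y ^ d - ?b ^ d = (Y - ?b) * V"
    unfolding U_def V_def X_minus[symmetric] by (rule power_diff_sumr2)+
  then have phi': "\<phi> = t * U + (Y - ?b) * V" using phi by simp
  have "expansion (?b ^ (d - Suc i) * Y ^ i) = fps_const b ^ (d - Suc i) * expansion Y ^ i" for i
    unfolding expansion_const[symmetric]
    by (simp only: expansion_mult expansion_power power_in_local_ring const_in_local_ring in_ring)
  then have "expansion V = (\<Sum>i<d. fps_const b ^ (d - Suc i) * expansion Y ^ i)"
    unfolding V_def
    by (subst expansion_sum) (auto intro!: mult_in_local_ring power_in_local_ring const_in_local_ring
        in_ring)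
  then have "fps_nth (expansion V) 0 = (\<Sum>i<d. b ^ (d - Suc i) * b ^ i)"
    by (simp add: fps_sum_nth fps_power_zeroth expansions)
  also have "\<dots> = (\<Sum>i<d. b ^ (d - 1))"
    by (intro sum.cong refl) (simp flip: power_add)
  \<comment> \<open>The constant term is \<open>d * b ^ (d - 1)\<close>, the partial derivative in
    \<open>y\<close> at the point; it is nonzero, so the tangent is not vertical and
    \<open>V\<close> is a unit.\<close>
  finally have "fps_nth (expansion V) 0 \<noteq> 0" using b d by simp
  then obtain W where W: "W \<in> local_ring p" "W * V = 1"
    using unit_in_local_ring[OF UV(2)] by blast
  have "W * \<phi> = W * t * U + (Y - ?b) * (W * V)"
    unfolding phi' by (simp only: distrib_left ac_simps)
  then have "Y = ?b + (- (W * U)) * t + W * \<phi>"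
    unfolding W(2) by (simp add: algebra_simps)
  then show ?thesis
    using residualI[of "- (W * U)" W b] W UV by (simp add: uminus_in_local_ring mult_in_local_ring)
qed

text \<open>Dehomogenization: division by \<open>PZ ^ n\<close> leaves a polynomial in
  \<open>X\<close> and \<open>Y\<close>, and \<open>residual\<close> is closed under sums and
  products.\<close>

lemma form_residual:
  assumes "form n P"
  shows "Fract P (PZ ^ n) \<in> residual"
  using assms
proof (induction rule: form_induct)
  case zero
  have "Fract 0 (PZ ^ n) = Fract (PC 0) 1" by (simp add: eq_fract)
  then show ?case using const_residual[of 0] by simp
next
  case (add P Q)
  have "Fract (P + Q) (PZ ^ n) = Fract P (PZ ^ n) + Fract Q (PZ ^ n)"
    by (simp add: eq_fract algebra_simps)
  then show ?case using add_residual[OF add] by metis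
next
  case (monomial c i j k)
  have "Fract (PC c * PX ^ i * PY ^ j * PZ ^ k) (PZ ^ n) = Fract (PC c) 1 * X ^ i * Y ^ j"
    unfolding X_def Y_def Fract_power monomial[symmetric]
    by (simp add: eq_fract power_add ac_simps)
  then show ?case
    using mult_residual[OF mult_residual] const_residual X_residual Y_residual power_residual by simp
qed

text \<open>After subtraction of the value \<open>c\<close> at the point, the numerator vanishes
  there. Its own constant \<open>c'\<close> is therefore 0, as seen along the branch, where
  \<open>t\<close> starts at 0 and \<open>\<phi>\<close> is 0. Multiplication by
  \<open>PZ ^ n / q\<close> then restores the denominator without creating a new constant.\<close>

lemma local_ring_decomposition:
  assumes "x \<in> local_ring p"
  obtains c r s where "r \<in> local_ring p" "s \<in> local_ring p" "x = Fract (PC c) 1 + r * t + s * \<phi>"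
proof -
  obtain m q n where x: "x = Fract m q" "form n m" "form n q" "eval3 q (vector [a, b, 1]) \<noteq> 0" "q \<noteq> 0"
    using assms(1) by (rule local_ringE)
  define c where "c = eval3 m (vector [a, b, 1]) / eval3 q (vector [a, b, 1])"
  have f: "form n (m - PC c * q)" using x by (intro form_diff form_PC_mult)
  then obtain c' r s where *: "r \<in> local_ring p" "s \<in> local_ring p"
      "Fract (m - PC c * q) (PZ ^ n) = Fract (PC c') 1 + r * t + s * \<phi>"
    using form_residual unfolding residual_def by blast
  have "expansion (Fract (m - PC c * q) (PZ ^ n)) = fps_eval3 curve_branch (m - PC c * q)"
    by (subst expansion_Fract[OF f form_power1[OF form_PZ]]) (simp_all del: fps_eval3_hom(7))
  then have "fps_nth (expansion (Fract (m - PC c * q) (PZ ^ n))) 0 = eval3 (m - PC c * q) (vector [a, b, 1])"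
    using eval_nth_0[OF f] by simp
  also have "\<dots> = 0" using x by (simp add: c_def)
  finally have "c' = 0"
    unfolding *(3) using *(1,2) in_ring t_nth
    by (simp add: expansion_add expansion_mult add_in_local_ring mult_in_local_ring
        const_in_local_ring expansions(4))
  then have eq: "Fract (m - PC c * q) (PZ ^ n) = r * t + s * \<phi>"
    using *(3) by (simp flip: Zero_fract_def)
  define u where "u = Fract (PZ ^ n) q"
  have u: "u \<in> local_ring p" unfolding u_def by (rule Fract_in_local_ring[OF form_power1[OF form_PZ] x(3,4)])
  have "x = Fract (PC c) 1 + Fract (m - PC c * q) (PZ ^ n) * u"
    using x(5) unfolding x(1) u_def by (simp add: eq_fract algebra_simps)
  also have "\<dots> = Fract (PC c) 1 + (r * u) * t + (s * u) * \<phi>"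
    unfolding eq by (simp add: algebra_simps)
  finally show ?thesis using that * u mult_in_local_ring by blast
qed

text \<open>Each step splits off one more power of \<open>t\<close>: the constant of the cofactor
  \<open>r\<close> is, up to a nonzero factor, coefficient \<open>n\<close> of the expansion, which
  vanishes.\<close>

lemma order_ge_decomposition:
  assumes "x \<in> local_ring p" "order_ge n (expansion x)"
  shows "\<exists>r\<in>local_ring p. \<exists>s\<in>local_ring p. x = r * t ^ n + s * \<phi>"
  using assms(2)
proof (induction n)
  case 0
  then show ?case
    using assms(1) zero_in_local_ring by (intro bexI[of _ x] bexI[of _ 0]) auto
next
  case (Suc n)
  then obtain r s where rs: "r \<in> local_ring p" "s \<in> local_ring p" "x = r * t ^ n + s * \<phi>"
    using order_ge_mono[of "Suc n" _ n] by auto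
  obtain c r' s' where r: "r' \<in> local_ring p" "s' \<in> local_ring p" "r = Fract (PC c) 1 + r' * t + s' * \<phi>"
    using local_ring_decomposition[OF rs(1)] by blast
  have "expansion x = expansion r * expansion t ^ n"
    using rs in_ring by (simp add: expansion_add expansion_mult expansion_power mult_in_local_ring
        power_in_local_ring expansions(4))
  moreover have "expansion r = fps_const c + expansion r' * expansion t"
    using r in_ring by (simp add: expansion_add expansion_mult mult_in_local_ring
        add_in_local_ring const_in_local_ring expansions(4))
  ultimately have e: "expansion x = fps_const c * expansion t ^ n + expansion r' * expansion t ^ Suc n"
    by (simp add: algebra_simps)
  have "order_ge (Suc n) (expansion r' * expansion t ^ Suc n)"
    by (rule order_ge_mult(2)[OF order_ge_power[OF t_nth(1)]])
  then have "fps_nth (expansion r' * expansion t ^ Suc n) n = 0"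
    unfolding order_ge_def by blast
  then have "fps_nth (expansion x) n = c * fps_nth (expansion t) 1 ^ n"
    unfolding e using startsby_zero_power_nth_same[OF t_nth(1)] by simp
  then have "c = 0"
    using Suc.prems t_nth(2) by (simp add: order_ge_def)
  then have "x = r' * t ^ Suc n + (s' * t ^ n + s) * \<phi>"
    using rs(3) r(3) by (simp add: algebra_simps flip: Zero_fract_def)
  then show ?case
    using r rs in_ring by (metis add_in_local_ring mult_in_local_ring power_in_local_ring)
qed

text \<open>Since \<open>n\<close> is the exact order of \<open>G\<close>, the decomposition of
  \<open>G\<close> itself has a unit as cofactor of \<open>t ^ n\<close>. So \<open>t ^ n\<close>
  lies in the ideal, and with it everything of order at least \<open>n\<close>.\<close>

lemma order_ge_local_ideal:
  assumes G: "form m G" "order_ge n (fps_eval3 curve_branch G)" "fps_nth (fps_eval3 curve_branch G) n \<noteq> 0"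
    and x: "x \<in> local_ring p" "order_ge n (expansion x)"
  shows "x \<in> local_ideal p G F"
proof -
  define \<gamma> where "\<gamma> = Fract G (PZ ^ m)"
  have \<gamma>: "\<gamma> \<in> local_ring p"
    unfolding \<gamma>_def using G(1) by (intro Fract_in_local_ring[of m] form_power1[OF form_PZ]) auto
  have e\<gamma>: "expansion \<gamma> = fps_eval3 curve_branch G"
    unfolding \<gamma>_def by (subst expansion_Fract[OF G(1) form_power1[OF form_PZ]]) auto
  obtain r s where rs: "r \<in> local_ring p" "s \<in> local_ring p" "\<gamma> = r * t ^ n + s * \<phi>"
    using order_ge_decomposition[OF \<gamma>, of n] G(2) e\<gamma> by auto
  have "expansion \<gamma> = expansion r * expansion t ^ n"
    using rs in_ring by (simp add: expansion_add expansion_mult expansion_power mult_in_local_ring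
        power_in_local_ring expansions(4))
  then have "fps_nth (expansion r) 0 \<noteq> 0"
    using G(3) unfolding e\<gamma>[symmetric]
    using order_ge_power[OF t_nth(1), of n]
    by (auto simp: fps_mult_nth order_ge_def sum.atLeast_Suc_atMost intro!: sum.neutral)
  then obtain u where u: "u \<in> local_ring p" "u * r = 1"
    using unit_in_local_ring[OF rs(1)] by blast
  obtain r' s' where x': "r' \<in> local_ring p" "s' \<in> local_ring p" "x = r' * t ^ n + s' * \<phi>"
    using order_ge_decomposition[OF x] by blast
  have "u * \<gamma> = (u * r) * t ^ n + u * s * \<phi>"
    unfolding rs(3) by (simp add: algebra_simps)
  then have tn: "t ^ n = u * \<gamma> - u * s * \<phi>" unfolding u(2) by simp
  have "x = (r' * u) * \<gamma> + (s' + - (r' * u * s)) * \<phi>"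
    unfolding x'(3) tn by (simp add: algebra_simps)
  moreover have "\<gamma> \<in> local_equations p G" "\<phi> \<in> local_equations p F"
    unfolding local_equations_def \<gamma>_def \<phi>_def
    using G(1) form_fermat form_power1[OF form_PZ] nonvanishing_iff[OF form_power1[OF form_PZ]]
    by (fastforce simp del: PZ_nz)+
  moreover have "r' * u \<in> local_ring p" "s' + - (r' * u * s) \<in> local_ring p"
    using x'(1,2) u(1) rs(1,2) by (auto intro!: add_in_local_ring mult_in_local_ring uminus_in_local_ring
        simp del: add_uminus_conv_diff)
  ultimately show ?thesis unfolding local_ideal_def by blast
qed

text \<open>If the pullback of \<open>G\<close> had exact order \<open>n < k\<close>, the ideal
  would contain everything of order at least \<open>n\<close> and cap the multiplicity at
  \<open>n\<close>. The converse is the lower bound for arcs, with \<open>F\<close> pulling back to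
  0.\<close>

lemma intersection_mult_ge_iff:
  assumes "form m G"
  shows "intersection_mult p G F \<ge> enat k \<longleftrightarrow> order_ge k (fps_eval3 curve_branch G)"
proof
  assume ge: "intersection_mult p G F \<ge> enat k"
  show "order_ge k (fps_eval3 curve_branch G)"
  proof (rule ccontr)
    assume "\<not> order_ge k (fps_eval3 curve_branch G)"
    then obtain i where i: "i < k" "fps_nth (fps_eval3 curve_branch G) i \<noteq> 0"
      by (auto simp: order_ge_def)
    define n where "n = (LEAST i. fps_nth (fps_eval3 curve_branch G) i \<noteq> 0)"
    have n: "fps_nth (fps_eval3 curve_branch G) n \<noteq> 0" "n \<le> i"
      unfolding n_def using i(2) by (rule LeastI, rule Least_le)
    have "order_ge n (fps_eval3 curve_branch G)"
      unfolding order_ge_def n_def using not_less_Least by blast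
    then have "intersection_mult p G F \<le> enat n"
      using order_ge_local_ideal[OF assms] n(1) intersection_mult_le by blast
    with ge have "enat k \<le> enat n" by (rule order_trans)
    with n i show False by simp
  qed
next
  assume "order_ge k (fps_eval3 curve_branch G)"
  then show "intersection_mult p G F \<ge> enat k"
    using t_nth(2) unfolding expansions(3)
    by (intro intersection_mult_ge[OF _ _ form_t _ _ form_PZ]) auto
qed

end

section \<open>Osculating conics of the Fermat curve\<close>

lemma order_ge_5_iff:
  "order_ge 5 f \<longleftrightarrow> fps_nth f 0 = 0 \<and> fps_nth f 1 = 0 \<and> fps_nth f 2 = 0 \<and> fps_nth f 3 = 0 \<and> fps_nth f 4 = 0"
  unfolding order_ge_def by (simp add: eval_nat_numeral All_less_Suc conj_ac)

lemma order_ge_6_iff: "order_ge 6 f \<longleftrightarrow> order_ge 5 f \<and> fps_nth f 5 = 0"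
  unfolding order_ge_def by (simp add: eval_nat_numeral All_less_Suc conj_ac)

section \<open>Conics in coordinates adapted to the point\<close>

definition conic_series ::
  "complex fps \<Rightarrow> complex fps \<Rightarrow> complex \<Rightarrow> complex \<Rightarrow> complex \<Rightarrow> complex \<Rightarrow> complex \<Rightarrow> complex \<Rightarrow> complex fps"
  where "conic_series \<xi> \<eta> c0 c1 c2 c3 c4 c5 = fps_const c0 + fps_const c1 * \<xi> + fps_const c2 * \<eta> +
    fps_const c3 * (\<xi> * \<xi>) + fps_const c4 * (\<xi> * \<eta>) + fps_const c5 * (\<eta> * \<eta>)"

context
  fixes \<xi> \<eta> :: "complex fps" and x2 x3 x4 y3 y4 y5 :: complex
  assumes \<xi>: "fps_nth \<xi> 0 = 0" "fps_nth \<xi> 1 = 1" "fps_nth \<xi> 2 = x2" "fps_nth \<xi> 3 = x3" "fps_nth \<xi> 4 = x4"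
    and \<eta>: "fps_nth \<eta> 0 = 0" "fps_nth \<eta> 1 = 0" "fps_nth \<eta> 2 = 1" "fps_nth \<eta> 3 = y3" "fps_nth \<eta> 4 = y4"
      "fps_nth \<eta> 5 = y5"
begin

text \<open>\<open>c0\<close> and \<open>c1\<close> are replaced by 0 once a lower degree has forced
  them to vanish, which keeps the later formulas short.\<close>

lemma conic_series_nth:
  "fps_nth (conic_series \<xi> \<eta> c0 c1 c2 c3 c4 c5) 0 = c0"
  "fps_nth (conic_series \<xi> \<eta> 0 c1 c2 c3 c4 c5) 1 = c1"
  "fps_nth (conic_series \<xi> \<eta> 0 0 c2 c3 c4 c5) 2 = c2 + c3"
  "fps_nth (conic_series \<xi> \<eta> 0 0 c2 c3 c4 c5) 3 = c2 * y3 + 2 * c3 * x2 + c4"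
  "fps_nth (conic_series \<xi> \<eta> 0 0 c2 c3 c4 c5) 4 = c2 * y4 + c3 * (2 * x3 + x2\<^sup>2) + c4 * (y3 + x2) + c5"
  "fps_nth (conic_series \<xi> \<eta> 0 0 c2 c3 c4 c5) 5 = c2 * y5 + c3 * (2 * x4 + 2 * x2 * x3)
     + c4 * (x3 + x2 * y3 + y4) + 2 * c5 * y3"
  using \<xi> \<eta> unfolding conic_series_def
  by (simp_all add: fps_mult_nth eval_nat_numeral algebra_simps)

text \<open>The system is triangular: degrees 0 to 4 determine \<open>c0\<close>, \<open>c1\<close>,
  \<open>c2\<close>, \<open>c4\<close>, \<open>c5\<close> in this order, each entering with
  coefficient 1. Only the scale \<open>c3\<close> stays free, whence the uniqueness of the
  osculating conic.\<close>

lemma conic_series_order_ge_5_iff: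
  "order_ge 5 (conic_series \<xi> \<eta> c0 c1 c2 c3 c4 c5) \<longleftrightarrow>
    c0 = 0 \<and> c1 = 0 \<and> c2 = - c3 \<and> c4 = c3 * (y3 - 2 * x2) \<and>
    c5 = c3 * (y4 - 2 * x3 - x2\<^sup>2 - (y3 - 2 * x2) * (y3 + x2))"
proof (cases "c0 = 0 \<and> c1 = 0")
  case True
  have 2: "c2 + c3 = 0 \<longleftrightarrow> c2 = - c3"
    by (simp add: eq_neg_iff_add_eq_0)
  have 3: "- c3 * y3 + 2 * c3 * x2 + c4 = 0 \<longleftrightarrow> c4 = c3 * (y3 - 2 * x2)"
    by (rule iffI; algebra)
  have 4: "- c3 * y4 + c3 * (2 * x3 + x2\<^sup>2) + c3 * (y3 - 2 * x2) * (y3 + x2) + c5 = 0 \<longleftrightarrow>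
      c5 = c3 * (y4 - 2 * x3 - x2\<^sup>2 - (y3 - 2 * x2) * (y3 + x2))"
    by (rule iffI; algebra)
  show ?thesis
    unfolding order_ge_5_iff using True 2 3 4 by (auto simp: conic_series_nth simp del: One_nat_def)
next
  case False
  then show ?thesis
    unfolding order_ge_5_iff using conic_series_nth(1)[of c0 c1 c2 c3 c4 c5]
      conic_series_nth(2)[of c1 c2 c3 c4 c5]
    by auto
qed

lemma conic_series_nth_5:
  "fps_nth (conic_series \<xi> \<eta> 0 0 (- c3) c3 (c3 * (y3 - 2 * x2))
      (c3 * (y4 - 2 * x3 - x2\<^sup>2 - (y3 - 2 * x2) * (y3 + x2)))) 5 =
    c3 * (- y5 + 2 * x4 + 2 * x2 * x3 + (y3 - 2 * x2) * (x3 + x2 * y3 + y4) +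
      2 * y3 * (y4 - 2 * x3 - x2\<^sup>2 - (y3 - 2 * x2) * (y3 + x2)))"
  unfolding conic_series_nth by (simp add: algebra_simps)

end

text \<open>\<open>s\<close> and \<open>q\<close> will be the sum and the product of
  \<open>B\<close> and \<open>- A\<close>. Then \<open>2 * s ^ 3 - 9 * s * q\<close> is the product
  of the three expressions "twice one minus the other two" in \<open>- A\<close>, \<open>0\<close>,
  \<open>B\<close>: it vanishes when one of these is the midpoint of the others.\<close>

lemma sextactic_discriminant:
  fixes e s q :: complex
  defines "x2 \<equiv> (e - 1) / 2 * s" and "x3 \<equiv> (e - 1) * (e - 2) / 6 * (s\<^sup>2 - q)"
    and "x4 \<equiv> (e - 1) * (e - 2) * (e - 3) / 24 * (s ^ 3 - 2 * s * q)"
    and "y3 \<equiv> (e - 2) / 3 * s" and "y4 \<equiv> (e - 2) * (e - 3) / 12 * (s\<^sup>2 - q)"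
    and "y5 \<equiv> (e - 2) * (e - 3) * (e - 4) / 60 * (s ^ 3 - 2 * s * q)"
  shows "- y5 + 2 * x4 + 2 * x2 * x3 + (y3 - 2 * x2) * (x3 + x2 * y3 + y4) +
      2 * y3 * (y4 - 2 * x3 - x2\<^sup>2 - (y3 - 2 * x2) * (y3 + x2)) =
    - ((e + 1) * (e - 2) * (2 * e - 1) * (s * (2 * s\<^sup>2 - 9 * q))) / 540"
  unfolding x2_def x3_def x4_def y3_def y4_def y5_def
  by (simp add: field_simps power2_eq_square power3_eq_cube)

lemma gbinomial_numerals:
  fixes e :: complex
  shows "e gchoose 1 = e" "e gchoose 2 = e * (e - 1) / 2" "e gchoose 3 = e * (e - 1) * (e - 2) / 6"
    "e gchoose 4 = e * (e - 1) * (e - 2) * (e - 3) / 24"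
    "e gchoose 5 = e * (e - 1) * (e - 2) * (e - 3) * (e - 4) / 120"
  by (simp_all add: gbinomial_prod_rev eval_nat_numeral fact_reduce prod.atLeast0_lessThan_Suc)

lemma product_of_linear_combinations:
  fixes P Q R :: poly3
  shows "(PC a1 * P + PC a2 * Q + PC a3 * R) * (PC b1 * P + PC b2 * Q + PC b3 * R) =
    PC (a3 * b3) * (R * R) + PC (a1 * b3 + a3 * b1) * (R * P) + PC (a2 * b3 + a3 * b2) * (R * Q) +
    PC (a1 * b1) * (P * P) + PC (a1 * b2 + a2 * b1) * (P * Q) + PC (a2 * b2) * (Q * Q)"
  unfolding PC_simps distrib_left distrib_right by (simp only: ac_simps)

definition conic_combination :: "poly3 \<Rightarrow> poly3 \<Rightarrow> poly3 \<Rightarrow> (nat \<Rightarrow> complex) \<Rightarrow> poly3" where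
  "conic_combination P Q R c = PC (c 0) * (R * R) + PC (c 1) * (R * P) + PC (c 2) * (R * Q) +
    PC (c 3) * (P * P) + PC (c 4) * (P * Q) + PC (c 5) * (Q * Q)"

lemma conic_combination_add:
  "conic_combination P Q R c + conic_combination P Q R c' = conic_combination P Q R (\<lambda>i. c i + c' i)"
  unfolding conic_combination_def PC_simps distrib_right by (simp only: add_ac)

lemma conic_combination_PC_mult:
  "PC k * conic_combination P Q R c = conic_combination P Q R (\<lambda>i. k * c i)"
  unfolding conic_combination_def PC_simps distrib_left by (simp only: mult.assoc)

text \<open>\<open>P\<close>, \<open>Q\<close>, \<open>R\<close> span the linear forms, so their
  pairwise products span the quadratic ones.\<close>

lemma form_2_conic_combination:
  assumes "PX = PC a1 * P + PC a2 * Q + PC a3 * R" "PY = PC b1 * P + PC b2 * Q + PC b3 * R"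
    and "PZ = PC c1 * P + PC c2 * Q + PC c3 * R" and "form 2 C"
  obtains c where "C = conic_combination P Q R c"
proof -
  let ?S = "\<lambda>C. \<exists>c. C = conic_combination P Q R c"
  have prod: "?S ((PC a1 * P + PC a2 * Q + PC a3 * R) * (PC b1 * P + PC b2 * Q + PC b3 * R))"
    for a1 a2 a3 b1 b2 b3
    unfolding product_of_linear_combinations conic_combination_def
    by (rule exI[of _ "\<lambda>i. [a3 * b3, a1 * b3 + a3 * b1, a2 * b3 + a3 * b2, a1 * b1,
          a1 * b2 + a2 * b1, a2 * b2] ! i"]) (simp only: nth_Cons_numeral nth_Cons_0 nth_Cons' , simp)
  have add: "?S (C + C')" if "?S C" "?S C'" for C C'
    using that conic_combination_add by metis
  have smult: "?S (PC k * C)" if "?S C" for k C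
    using that conic_combination_PC_mult by metis
  obtain k1 k2 k3 k4 k5 k6 where C: "C = PC k1 * PX ^ 2 + PC k2 * PX * PY + PC k3 * PY ^ 2 +
      PC k4 * PX * PZ + PC k5 * PY * PZ + PC k6 * PZ ^ 2"
    using form_2_cases[OF assms(4)] by blast
  have "?S (PX * PX)" "?S (PX * PY)" "?S (PY * PY)" "?S (PX * PZ)" "?S (PY * PZ)" "?S (PZ * PZ)"
    unfolding assms(1-3) by (rule prod)+
  then have "?S C"
    unfolding C power2_eq_square mult.assoc by (intro add smult)
  then show ?thesis using that by blast
qed

text \<open>Because \<open>B - (- A) = - 1\<close>, the differences \<open>B ^ n - (- A) ^ n\<close>
  are the negated complete homogeneous polynomials of degree \<open>n - 1\<close> in
  \<open>B\<close> and \<open>- A\<close>: 1, \<open>s\<close>, \<open>s\<^sup>2 - q\<close>,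
  \<open>s ^ 3 - 2 * s * q\<close>. The first five lines are the coefficients of
  \<open>L\<xi>\<close> in degrees 0 to 4, the others those of \<open>L\<eta>\<close> in degrees 1
  to 5.\<close>

lemma normalized_binomial_coefficients:
  fixes e A B :: complex
  assumes "e \<noteq> 0" "e - 1 \<noteq> 0" "B = - 1 - A"
  defines "s \<equiv> B - A" and "q \<equiv> A * (1 + A)"
  shows "(e gchoose 0) / e * ((- A) ^ 0 - B ^ 0) = 0"
    "(e gchoose 1) / e * ((- A) ^ 1 - B ^ 1) = 1"
    "(e gchoose 2) / e * ((- A) ^ 2 - B ^ 2) = (e - 1) / 2 * s"
    "(e gchoose 3) / e * ((- A) ^ 3 - B ^ 3) = (e - 1) * (e - 2) / 6 * (s\<^sup>2 - q)"
    "(e gchoose 4) / e * ((- A) ^ 4 - B ^ 4) = (e - 1) * (e - 2) * (e - 3) / 24 * (s ^ 3 - 2 * s * q)"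
    "(e gchoose 1) * (- 2 / (e * (e - 1))) * (B ^ 0 - (- A) ^ 0) = 0"
    "(e gchoose 2) * (- 2 / (e * (e - 1))) * (B ^ 1 - (- A) ^ 1) = 1"
    "(e gchoose 3) * (- 2 / (e * (e - 1))) * (B ^ 2 - (- A) ^ 2) = (e - 2) / 3 * s"
    "(e gchoose 4) * (- 2 / (e * (e - 1))) * (B ^ 3 - (- A) ^ 3) = (e - 2) * (e - 3) / 12 * (s\<^sup>2 - q)"
    "(e gchoose 5) * (- 2 / (e * (e - 1))) * (B ^ 4 - (- A) ^ 4) =
      (e - 2) * (e - 3) * (e - 4) / 60 * (s ^ 3 - 2 * s * q)"
proof -
  have pow: "B ^ 1 - (- A) ^ 1 = - 1" "B ^ 2 - (- A) ^ 2 = - s" "B ^ 3 - (- A) ^ 3 = - (s\<^sup>2 - q)"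
    "B ^ 4 - (- A) ^ 4 = - (s ^ 3 - 2 * s * q)"
    unfolding s_def q_def assms(3) by algebra+
  have pow': "(- A) ^ 1 - B ^ 1 = 1" "(- A) ^ 2 - B ^ 2 = s" "(- A) ^ 3 - B ^ 3 = s\<^sup>2 - q"
    "(- A) ^ 4 - B ^ 4 = s ^ 3 - 2 * s * q"
    unfolding minus_diff_eq[of "B ^ n" "(- A) ^ n" for n, symmetric] pow by simp_all
  show "(e gchoose 0) / e * ((- A) ^ 0 - B ^ 0) = 0"
    "(e gchoose 1) / e * ((- A) ^ 1 - B ^ 1) = 1"
    "(e gchoose 2) / e * ((- A) ^ 2 - B ^ 2) = (e - 1) / 2 * s"
    "(e gchoose 3) / e * ((- A) ^ 3 - B ^ 3) = (e - 1) * (e - 2) / 6 * (s\<^sup>2 - q)"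
    "(e gchoose 4) / e * ((- A) ^ 4 - B ^ 4) = (e - 1) * (e - 2) * (e - 3) / 24 * (s ^ 3 - 2 * s * q)"
    unfolding pow' gbinomial_numerals using assms(1) by simp_all
  show "(e gchoose 1) * (- 2 / (e * (e - 1))) * (B ^ 0 - (- A) ^ 0) = 0"
    "(e gchoose 2) * (- 2 / (e * (e - 1))) * (B ^ 1 - (- A) ^ 1) = 1"
    "(e gchoose 3) * (- 2 / (e * (e - 1))) * (B ^ 2 - (- A) ^ 2) = (e - 2) / 3 * s"
    "(e gchoose 4) * (- 2 / (e * (e - 1))) * (B ^ 3 - (- A) ^ 3) = (e - 2) * (e - 3) / 12 * (s\<^sup>2 - q)"
    "(e gchoose 5) * (- 2 / (e * (e - 1))) * (B ^ 4 - (- A) ^ 4) =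
      (e - 2) * (e - 3) * (e - 4) / 60 * (s ^ 3 - 2 * s * q)"
    unfolding pow gbinomial_numerals using assms(1,2) by (simp_all add: divide_simps) algebra+
qed

section \<open>Zero loci and tangent lines of the Fermat curve\<close>

lemma subspace_zero_locus_iff:
  assumes "form n G" "v \<noteq> 0"
  shows "vec.span {v} \<in> zero_locus G \<longleftrightarrow> eval3 G v = 0"
proof -
  have "vec.span {v} \<in> proj_plane"
    unfolding proj_plane_def using assms(2) by (simp add: vec.dim_eq_card_independent)
  then show ?thesis
    unfolding zero_locus_def
    using assms(1) vec.span_base[of v "{v}"] by (auto simp: vec.span_singleton eval3_scale)
qed

lemma derivative_monomial:
  "dX (PC c * PX ^ i * PY ^ j * PZ ^ k) = PC (of_nat i * c) * PX ^ (i - 1) * PY ^ j * PZ ^ k"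
  "dY (PC c * PX ^ i * PY ^ j * PZ ^ k) = PC (of_nat j * c) * PX ^ i * PY ^ (j - 1) * PZ ^ k"
  "dZ (PC c * PX ^ i * PY ^ j * PZ ^ k) = PC (of_nat k * c) * PX ^ i * PY ^ j * PZ ^ (k - 1)"
proof -
  have of_nat_monom: "of_nat n * monom c m = monom (of_nat n * c) m" for n m and c :: "'x::comm_semiring_1"
    by (simp add: of_nat_poly smult_monom)
  show "dX (PC c * PX ^ i * PY ^ j * PZ ^ k) = PC (of_nat i * c) * PX ^ (i - 1) * PY ^ j * PZ ^ k"
    "dY (PC c * PX ^ i * PY ^ j * PZ ^ k) = PC (of_nat j * c) * PX ^ i * PY ^ (j - 1) * PZ ^ k"
    "dZ (PC c * PX ^ i * PY ^ j * PZ ^ k) = PC (of_nat k * c) * PX ^ i * PY ^ j * PZ ^ (k - 1)"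
    unfolding monom_eq_PC[symmetric] dX_def dY_def dZ_def
    by (simp_all add: map_poly_monom pderiv_monom of_nat_monom)
qed

lemma derivative_add: "dX (P + Q) = dX P + dX Q" "dY (P + Q) = dY P + dY Q" "dZ (P + Q) = dZ P + dZ Q"
  unfolding dX_def dY_def dZ_def
  by (intro poly_eqI; simp add: coeff_map_poly pderiv_add)+

lemma fermat_gradient:
  "dX (fermat d) = PC (of_nat d) * PX ^ (d - 1)" "dY (fermat d) = PC (of_nat d) * PY ^ (d - 1)"
  "dZ (fermat d) = PC (of_nat d) * PZ ^ (d - 1)"
  unfolding fermat_def derivative_add
  using derivative_monomial[of 1 d 0 0] derivative_monomial[of 1 0 d 0] derivative_monomial[of 1 0 0 d]
  by simp_all

lemma tangent_form_fermat:
  "tangent_form (fermat d) v = PC (of_nat d * v $ 1 ^ (d - 1)) * PX +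
    PC (of_nat d * v $ 2 ^ (d - 1)) * PY + PC (of_nat d * v $ 3 ^ (d - 1)) * PZ"
  unfolding tangent_form_def fermat_gradient by simp

lemma form_tangent_form: "form 1 (tangent_form F v)"
  unfolding tangent_form_def by (intro form_add form_PC_mult form_PX form_PY form_PZ)

context fermat_point
begin

definition "e = (1 / of_nat d :: complex)"
abbreviation "A \<equiv> a ^ d"
abbreviation "B \<equiv> b ^ d"

text \<open>Linear forms vanishing at the point to orders one and two along the curve; \<open>L\<eta>\<close> defines the
  tangent line.\<close>

definition "L\<xi> = PC (- 1 / (e * a)) * PX + PC (1 / (e * b)) * PY"
definition "L\<eta> = PC (- 2 / (e * (e - 1) * A * B)) * (PC (A / a) * PX + PC (B / b) * PY + PZ)"

lemma e: "e \<noteq> 0" "e - 1 \<noteq> 0"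
  using d by (auto simp: e_def)

lemma AB: "A \<noteq> 0" "B \<noteq> 0" "B = - 1 - A"
  using a b on_curve by (auto simp: algebra_simps eq_neg_iff_add_eq_0)

text \<open>The inverse change of linear forms: together with \<open>PZ\<close>, the forms
  \<open>L\<xi>\<close> and \<open>L\<eta>\<close> span all of them. The coefficients
  \<open>- A\<close> and \<open>- B\<close> add up to 1, which isolates \<open>PX\<close> and
  \<open>PY\<close>.\<close>

lemma coordinates:
  "PX = PC (a * e * B) * L\<xi> + PC (a * e * (e - 1) * A * B / 2) * L\<eta> + PC a * PZ"
  "PY = PC (- b * e * A) * L\<xi> + PC (b * e * (e - 1) * A * B / 2) * L\<eta> + PC b * PZ"
proof -
  have "PC (k * (e * (e - 1) * A * B) / 2) * L\<eta> =
      PC (k * (e * (e - 1) * A * B) / 2 * (- 2 / (e * (e - 1) * A * B))) * (PC (A / a) * PX + PC (B / b) * PY + PZ)" for k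
    unfolding L\<eta>_def PC_simps(4) by (simp only: mult.assoc)
  also have "\<dots> k = PC (- k * A / a) * PX + PC (- k * B / b) * PY + PC (- k) * PZ" for k
    using e AB(1,2) by (simp add: distrib_left flip: mult.assoc PC_simps(4))
  finally have \<eta>: "PC (k * (e * (e - 1) * A * B) / 2) * L\<eta> =
    PC (- k * A / a) * PX + PC (- k * B / b) * PY + PC (- k) * PZ" for k .
  have \<xi>: "PC k * L\<xi> = PC (- k / (e * a)) * PX + PC (k / (e * b)) * PY" for k
    unfolding L\<xi>_def distrib_left mult.assoc[symmetric] PC_simps(4)[symmetric] by simp
  have 1: "PC (- B) * PX + PC (- A) * PX = PX" "PC (- A) * PY + PC (- B) * PY = PY"
    unfolding distrib_right[symmetric] PC_simps(3)[symmetric] AB(3) by simp_all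
  have "PC (a * e * B) * L\<xi> + PC (a * (e * (e - 1) * A * B) / 2) * L\<eta> + PC a * PZ =
      PC (- B) * PX + PC (- A) * PX"
    unfolding \<xi> \<eta> using e a b by simp
  then show "PX = PC (a * e * B) * L\<xi> + PC (a * e * (e - 1) * A * B / 2) * L\<eta> + PC a * PZ"
    unfolding 1 by (simp only: mult.assoc)
  have "PC (- b * e * A) * L\<xi> + PC (b * (e * (e - 1) * A * B) / 2) * L\<eta> + PC b * PZ =
      PC (- A) * PY + PC (- B) * PY"
    unfolding \<xi> \<eta> using e a b by simp
  then show "PY = PC (- b * e * A) * L\<xi> + PC (b * e * (e - 1) * A * B / 2) * L\<eta> + PC b * PZ"
    unfolding 1 by (simp only: mult.assoc)
qed

text \<open>The constant term cancels, and \<open>- A - B = 1\<close> together with the factor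
  \<open>1 / e\<close> makes the linear coefficient 1.\<close>

lemma eval_L\<xi>: "fps_nth (fps_eval3 curve_branch L\<xi>) n = (e gchoose n) / e * ((- A) ^ n - B ^ n)"
  using e(1) a b by (simp add: L\<xi>_def curve_branch_def field_simps flip: e_def)

text \<open>\<open>A * B\<close> splits off from
  \<open>A * B ^ (n + 1) + B * (- A) ^ (n + 1)\<close> and lowers the exponents by one, so the
  linear term vanishes too.\<close>

lemma eval_tangent:
  "fps_nth (fps_eval3 curve_branch (PC (A / a) * PX + PC (B / b) * PY + PZ)) 0 = 0"
  "fps_nth (fps_eval3 curve_branch (PC (A / a) * PX + PC (B / b) * PY + PZ)) (Suc n) =
    (e gchoose (Suc n)) * A * B * (B ^ n - (- A) ^ n)"
  using a b AB(3) by (simp_all add: curve_branch_def algebra_simps flip: e_def)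

text \<open>The scaling of \<open>L\<eta>\<close> is the one that makes the quadratic coefficient
  1.\<close>

lemma eval_L\<eta>: "fps_nth (fps_eval3 curve_branch L\<eta>) 0 = 0"
  "fps_nth (fps_eval3 curve_branch L\<eta>) (Suc n) =
    (e gchoose (Suc n)) * (- 2 / (e * (e - 1))) * (B ^ n - (- A) ^ n)"
proof -
  have cancel: "- 2 / (e * (e - 1) * x * y) * (g * x * y * z) = g * (- 2 / (e * (e - 1))) * z"
    if "x \<noteq> 0" "y \<noteq> 0" for x y z g
    using that by (simp add: divide_simps)
  show "fps_nth (fps_eval3 curve_branch L\<eta>) 0 = 0"
    "fps_nth (fps_eval3 curve_branch L\<eta>) (Suc n) =
      (e gchoose (Suc n)) * (- 2 / (e * (e - 1))) * (B ^ n - (- A) ^ n)"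
    unfolding L\<eta>_def fps_eval3_hom(4)[of curve_branch "PC k" for k] fps_eval3_gens(1)
      fps_mult_left_const_nth eval_tangent cancel[OF AB(1,2)]
    by simp_all
qed

text \<open>The pulled back tangent form has as quadratic coefficient a nonzero multiple of
  \<open>(e gchoose 2) * A * B\<close>, so the contact is exactly two. Another representative of the
  point only rescales the form by \<open>k ^ (d - 1)\<close>.\<close>

lemma not_inflection_point: "\<not> inflection_point F p"
proof
  assume "inflection_point F p"
  then obtain v where v: "v \<in> p" "v \<noteq> 0" "intersection_mult p (tangent_form F v) F \<ge> 3"
    unfolding inflection_point_def by blast
  then obtain k where k: "v = k *s vector [a, b, 1]" "k \<noteq> 0"
    by (auto simp: vec.span_singleton)
  have pow: "A / a = a ^ (d - 1)" "B / b = b ^ (d - 1)"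
    using a b d by (simp_all add: power_diff)
  have tan: "tangent_form F v = PC (of_nat d * k ^ (d - 1)) * (PC (A / a) * PX + PC (B / b) * PY + PZ)"
    unfolding tangent_form_fermat k pow by (simp add: power_mult_distrib algebra_simps)
  have "order_ge 3 (fps_eval3 curve_branch (tangent_form F v))"
    using v(3) intersection_mult_ge_iff[OF form_tangent_form, of 3] by (simp add: numeral_eq_enat)
  then have "fps_nth (fps_eval3 curve_branch (tangent_form F v)) (Suc 1) = 0"
    by (simp add: order_ge_def)
  then have "(e gchoose 2) * A * B * (B ^ 1 - (- A) ^ 1) = 0"
    unfolding tan fps_eval3_hom(4)[of curve_branch "PC k" for k] fps_eval3_gens(1) fps_mult_left_const_nth eval_tangent
    using k(2) d by (simp add: numeral_2_eq_2)
  moreover have "B ^ 1 - (- A) ^ 1 = - 1" using AB(3) by simp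
  ultimately show False using e AB(1,2) by (auto simp: gbinomial_numerals)
qed

lemma on_curve_point: "p \<in> zero_locus F"
proof -
  have "vector [a, b, 1] \<noteq> (0 :: complex ^ 3)"
    using a by (metis vector_3(1) zero_index)
  then show ?thesis
    unfolding subspace_zero_locus_iff[OF form_fermat \<open>_ \<noteq> 0\<close>] using on_curve by (simp add: fermat_def)
qed

lemma sextactic_point_iff:
  assumes "d \<ge> 3"
  shows "sextactic_point F p \<longleftrightarrow> A = B \<or> A = 1 \<or> B = 1"
proof -
  define s q where "s = B - A" and "q = A * (1 + A)"
  define x2 x3 x4 y3 y4 y5 where "x2 = (e - 1) / 2 * s" and "x3 = (e - 1) * (e - 2) / 6 * (s\<^sup>2 - q)"
    and "x4 = (e - 1) * (e - 2) * (e - 3) / 24 * (s ^ 3 - 2 * s * q)"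
    and "y3 = (e - 2) / 3 * s" and "y4 = (e - 2) * (e - 3) / 12 * (s\<^sup>2 - q)"
    and "y5 = (e - 2) * (e - 3) * (e - 4) / 60 * (s ^ 3 - 2 * s * q)"
  note defs = x2_def x3_def x4_def y3_def y4_def y5_def
  define \<xi> \<eta> where "\<xi> = fps_eval3 curve_branch L\<xi>" and "\<eta> = fps_eval3 curve_branch L\<eta>"
  note nbc = normalized_binomial_coefficients[OF e AB(3), folded s_def q_def, folded defs]
  have \<xi>: "fps_nth \<xi> 0 = 0" "fps_nth \<xi> 1 = 1" "fps_nth \<xi> 2 = x2" "fps_nth \<xi> 3 = x3" "fps_nth \<xi> 4 = x4"
    unfolding \<xi>_def eval_L\<xi> by (rule nbc)+
  have suc: "(1::nat) = Suc 0" "(2::nat) = Suc 1" "(3::nat) = Suc 2" "(4::nat) = Suc 3" "(5::nat) = Suc 4"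
    by simp_all
  have \<eta>: "fps_nth \<eta> 0 = 0" "fps_nth \<eta> 1 = 0" "fps_nth \<eta> 2 = 1" "fps_nth \<eta> 3 = y3" "fps_nth \<eta> 4 = y4"
      "fps_nth \<eta> 5 = y5"
    unfolding \<eta>_def using eval_L\<eta>(1) eval_L\<eta>(2)[of 0, folded suc] eval_L\<eta>(2)[of 1, folded suc(2)]
      eval_L\<eta>(2)[of 2, folded suc(3)] eval_L\<eta>(2)[of 3, folded suc(4)] eval_L\<eta>(2)[of 4, folded suc(5)] nbc(6-10)
    by simp_all
  \<comment> \<open>The solution of the triangular system at scale \<open>c3 = 1\<close>.\<close>
  define k4 k5 where "k4 = y3 - 2 * x2" and "k5 = y4 - 2 * x3 - x2\<^sup>2 - (y3 - 2 * x2) * (y3 + x2)"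
  define c0 where "c0 = (\<lambda>_. 0)(2 := -1, 3 := 1, 4 := k4, (5::nat) := k5)"
  define Osc where "Osc = conic_combination L\<xi> L\<eta> PZ c0"
  have eval: "fps_eval3 curve_branch (conic_combination L\<xi> L\<eta> PZ c) =
      conic_series \<xi> \<eta> (c 0) (c 1) (c 2) (c 3) (c 4) (c 5)" for c
    unfolding conic_combination_def conic_series_def \<xi>_def \<eta>_def by simp
  have L: "form 1 L\<xi>" "form 1 L\<eta>"
    unfolding L\<xi>_def L\<eta>_def by (intro form_add form_PC_mult form_PX form_PY form_PZ)+
  have form_Osc: "form 2 Osc"
    unfolding Osc_def conic_combination_def one_add_one[symmetric]
    by (intro form_add form_PC_mult form_mult L form_PZ)
  have PZ: "PZ = PC 0 * L\<xi> + PC 0 * L\<eta> + PC 1 * PZ" by simp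
  have ge_5: "order_ge 5 (fps_eval3 curve_branch C) \<longleftrightarrow> (\<exists>k. C = PC k * Osc)" if C: "form 2 C" for C
  proof
    obtain c where c: "C = conic_combination L\<xi> L\<eta> PZ c"
      using form_2_conic_combination[OF coordinates PZ C] by blast
    assume "order_ge 5 (fps_eval3 curve_branch C)"
    then have "c 0 = 0" "c 1 = 0" "c 2 = - c 3" "c 4 = c 3 * k4" "c 5 = c 3 * k5"
      unfolding c eval conic_series_order_ge_5_iff[OF \<xi> \<eta>] k4_def k5_def by auto
    then have "C = conic_combination L\<xi> L\<eta> PZ (\<lambda>i. c 3 * c0 i)"
      unfolding c conic_combination_def by (simp add: c0_def)
    then show "\<exists>k. C = PC k * Osc"
      unfolding Osc_def conic_combination_PC_mult by blast
  next
    assume "\<exists>k. C = PC k * Osc"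
    then obtain k where k: "C = PC k * Osc" ..
    show "order_ge 5 (fps_eval3 curve_branch C)"
      unfolding k Osc_def conic_combination_PC_mult eval conic_series_order_ge_5_iff[OF \<xi> \<eta>]
      by (simp add: c0_def k4_def k5_def)
  qed
  have "fps_nth (fps_eval3 curve_branch Osc) 5 =
      - ((e + 1) * (e - 2) * (2 * e - 1) * (s * (2 * s\<^sup>2 - 9 * q))) / 540"
    using conic_series_nth_5[OF \<xi> \<eta>, of 1] sextactic_discriminant[of e s q, folded defs]
    unfolding Osc_def eval by (simp add: c0_def k4_def k5_def)
  \<comment> \<open>\<open>2 * e - 1\<close> would vanish for \<open>d = 2\<close>; here
    \<open>d \<ge> 3\<close> enters.\<close>
  moreover have "e + 1 \<noteq> 0" "e - 2 \<noteq> 0" "2 * e - 1 \<noteq> 0"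
  proof -
    have eq: "e + 1 = complex_of_real (1 / real d + 1)" "e - 2 = complex_of_real (1 / real d - 2)"
      "2 * e - 1 = complex_of_real (2 * (1 / real d) - 1)"
      by (simp_all add: e_def)
    have "1 / real d + 1 \<noteq> 0" "1 / real d - 2 \<noteq> 0" "2 * (1 / real d) - 1 \<noteq> 0"
      using assms by (auto simp: field_simps)
    then show "e + 1 \<noteq> 0" "e - 2 \<noteq> 0" "2 * e - 1 \<noteq> 0"
      unfolding eq of_real_eq_0_iff by blast+
  qed
  moreover have "s * (2 * s\<^sup>2 - 9 * q) = (B - A) * ((A - 1) * (B - 1))"
    unfolding s_def q_def AB(3) by algebra
  ultimately have nth_5: "fps_nth (fps_eval3 curve_branch Osc) 5 = 0 \<longleftrightarrow> A = B \<or> A = 1 \<or> B = 1"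
    by auto
  \<comment> \<open>The test point is the intersection of the tangent line with
    \<open>z = 0\<close>. There \<open>L\<eta>\<close> and \<open>PZ\<close> vanish and
    \<open>Osc\<close> reduces to the square of \<open>L\<xi>\<close>.\<close>
  have "eval3 Osc (vector [a * B, - b * A, 0]) \<noteq> 0"
  proof -
    have "eval3 L\<xi> (vector [a * B, - b * A, 0]) = - (A + B) / e"
      using a b e(1) by (simp add: L\<xi>_def field_simps)
    moreover have "eval3 L\<eta> (vector [a * B, - b * A, 0]) = 0"
    proof -
      have "A / a * (a * B) + B / b * (- b * A) = 0" using a b by simp
      then show ?thesis unfolding L\<eta>_def by simp
    qed
    ultimately show ?thesis
      using AB(3) e(1) by (simp add: Osc_def conic_combination_def c0_def)
  qed
  then have "Osc \<noteq> 0" by auto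
  then have conic: "conic Osc" using form_Osc by (simp add: conic_def)
  have ge: "intersection_mult p C F \<ge> numeral n \<longleftrightarrow> order_ge (numeral n) (fps_eval3 curve_branch C)"
    if "form 2 C" for C n
    using intersection_mult_ge_iff[OF that, of "numeral n"] by (simp add: numeral_eq_enat)
  have osc: "osculating_conic F p Osc"
    unfolding osculating_conic_def using conic ge ge_5 ge_5[OF form_Osc] by (auto simp: conic_def intro: exI[of _ 1])
  \<comment> \<open>Any osculating conic is a nonzero multiple of \<open>Osc\<close>, so the
    coefficient of \<open>Osc\<close> decides hyperosculation for all of them.\<close>
  have "fps_nth (fps_eval3 curve_branch Osc) 5 = 0" if "osculating_conic F p C" "intersection_mult p C F \<ge> 6" for C
  proof -
    have C: "C \<noteq> 0" "form 2 C" "order_ge 5 (fps_eval3 curve_branch C)" "order_ge 6 (fps_eval3 curve_branch C)"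
      using that ge by (auto simp: osculating_conic_def conic_def)
    then obtain k where k: "C = PC k * Osc" using ge_5 by blast
    then have "k \<noteq> 0" using C(1) by auto
    then show ?thesis using C(4) unfolding order_ge_6_iff k by simp
  qed
  moreover have "intersection_mult p Osc F \<ge> 6" if "fps_nth (fps_eval3 curve_branch Osc) 5 = 0"
    using that osc ge[OF form_Osc] by (simp add: osculating_conic_def order_ge_6_iff)
  ultimately show ?thesis
    unfolding sextactic_point_def nth_5[symmetric] using on_curve_point not_inflection_point osc by blast
qed

end

section \<open>The sextactic points\<close>

lemma proj_plane_iff: "p \<in> proj_plane \<longleftrightarrow> (\<exists>v. v \<noteq> 0 \<and> p = vec.span {v})"
proof
  assume "p \<in> proj_plane"
  then have p: "vec.subspace p" "vec.dim p = 1" by (auto simp: proj_plane_def)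
  obtain B where B: "B \<subseteq> p" "vec.independent B" "p \<subseteq> vec.span B" "card B = 1"
    using vec.basis_exists[of p] p(2) by metis
  then obtain v where v: "B = {v}" by (auto simp: card_1_singleton_iff)
  then have "p = vec.span {v}" using B p(1) vec.span_subspace by blast
  moreover have "v \<noteq> 0" using B(2) v vec.dependent_zero by blast
  ultimately show "\<exists>v. v \<noteq> 0 \<and> p = vec.span {v}" by blast
next
  assume "\<exists>v. v \<noteq> 0 \<and> p = vec.span {v}"
  then show "p \<in> proj_plane"
    unfolding proj_plane_def by (auto simp: vec.dim_eq_card_independent)
qed

lemma proj_planeE:
  assumes "p \<in> proj_plane" obtains v where "v \<noteq> 0" "p = vec.span {v}"
  using assms proj_plane_iff by blast

lemma span_eqE:
  fixes v w :: "complex ^ 3"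
  assumes "vec.span {v} = vec.span {w}" "w \<noteq> 0"
  obtains k where "k \<noteq> 0" "w = k *s v"
proof -
  have "w \<in> vec.span {v}" using assms(1) vec.span_base[of w "{w}"] by simp
  then obtain k where "w = k *s v" by (auto simp: vec.span_singleton)
  then show ?thesis using that[of k] assms(2) by (cases "k = 0") auto
qed

lemma span_scale:
  fixes v :: "complex ^ 3"
  assumes "k \<noteq> 0"
  shows "vec.span {k *s v} = vec.span {v}"
proof -
  have "x *s v \<in> range (\<lambda>x. x *s (k *s v))" for x
    by (rule range_eqI[of _ _ "x / k"]) (simp add: assms)
  moreover have "x *s (k *s v) \<in> range (\<lambda>x. x *s v)" for x
    by (rule range_eqI[of _ _ "x * k"]) simp
  ultimately show ?thesis unfolding vec.span_singleton by blast
qed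

definition PV :: "3 \<Rightarrow> poly3" where
  "PV i = (if i = 1 then PX else if i = 2 then PY else PZ)"

lemma PV_simps [simp]: "PV 1 = PX" "PV 2 = PY" "PV 3 = PZ"
  by (simp_all add: PV_def)

lemma eval3_PV [simp]: "eval3 (PV i) v = v $ i"
  using exhaust_3[of i] by auto

lemma form_PV: "form 1 (PV i)"
  using exhaust_3[of i] by (metis PV_simps form_PX form_PY form_PZ)

lemma fps_eval3_PV [simp]: "fps_eval3 g (PV i) = g $ i"
  using exhaust_3[of i] by auto

text \<open>Moving only the zero coordinate gives an arc along the tangent line, since the tangent
  form has coefficient 0 at index \<open>i\<close>, and the Fermat form pulls back to
  \<open>fps_X ^ d\<close>. Both orders are at least 3, and the lower bound on the multiplicity
  suffices.\<close>

lemma inflection_point_coordinate_zero: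
  assumes "d \<ge> 3" "v \<noteq> 0" "eval3 (fermat d) v = 0" "v $ i = 0"
  shows "inflection_point (fermat d) (vec.span {v})"
proof -
  define g :: "complex fps ^ 3" where "g = (\<chi> j. fps_const (v $ j) + (if j = i then fps_X else 0))"
  interpret branch v g
    by unfold_locales (simp add: g_def)
  obtain j where j: "v $ j \<noteq> 0" using assms(2) by (metis vec_eq_iff zero_index)
  have pow: "g $ j ^ d = fps_const (v $ j ^ d) + (if j = i then fps_X ^ d else 0)" for j
    using assms(1,4) by (auto simp: g_def fps_const_power)
  have fermat: "fps_eval3 g (fermat d) = fps_const (eval3 (fermat d) v) + fps_X ^ d"
    unfolding fermat_def fps_eval3_hom fps_eval3_gens eval3_hom eval3_gens pow fps_const_add[symmetric]
    using exhaust_3[of i] by (elim disjE) (simp_all add: add.assoc)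
  have F: "order_ge 3 (fps_eval3 g (fermat d))"
    unfolding fermat assms(3) using order_ge_mono[OF order_ge_power[of fps_X d] assms(1)] by simp
  have lin: "fps_const (c * v $ j ^ (d - 1)) * g $ j = fps_const (c * v $ j ^ d)" for j :: 3 and c :: complex
  proof -
    have "v $ j ^ (d - 1) * v $ j = v $ j ^ d"
      using assms(1) by (intro power_minus_mult) simp
    then show ?thesis
      using assms(1,4) by (cases "j = i") (simp_all add: g_def mult.assoc power_0_left)
  qed
  have "fps_eval3 g (tangent_form (fermat d) v) = fps_const (of_nat d * eval3 (fermat d) v)"
    unfolding tangent_form_fermat fps_eval3_hom fps_eval3_gens lin
    by (simp add: fermat_def algebra_simps)
  then have T: "order_ge 3 (fps_eval3 g (tangent_form (fermat d) v))"
    using assms(3) by simp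
  have "intersection_mult p (tangent_form (fermat d) v) (fermat d) \<ge> 3"
    using intersection_mult_ge[OF T F form_PV[of i] _ _ form_PV[of j]] assms(4) j
    by (simp add: numeral_eq_enat g_def)
  then show ?thesis
    unfolding inflection_point_def
    using assms(2,3) vec.span_base[of v "{v}"] subspace_zero_locus_iff[OF form_fermat assms(2)] by blast
qed

text \<open>Off the coordinate triangle the point is scaled to third coordinate 1, where
  \<open>sextactic_point_iff\<close> applies; the other points of the curve are inflection
  points.\<close>

lemma sextactic_point_fermat_iff:
  assumes "d \<ge> 3" "v \<noteq> 0"
  shows "sextactic_point (fermat d) (vec.span {v}) \<longleftrightarrow>
    (\<forall>i. v $ i \<noteq> 0) \<and> v $ 1 ^ d + v $ 2 ^ d + v $ 3 ^ d = 0 \<and>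
    (v $ 1 ^ d = v $ 2 ^ d \<or> v $ 1 ^ d = v $ 3 ^ d \<or> v $ 2 ^ d = v $ 3 ^ d)"
proof (cases "eval3 (fermat d) v = 0 \<and> (\<forall>i. v $ i \<noteq> 0)")
  case True
  define a b where "a = v $ 1 / v $ 3" and "b = v $ 2 / v $ 3"
  have nz: "v $ 1 \<noteq> 0" "v $ 2 \<noteq> 0" "v $ 3 \<noteq> 0" using True by auto
  have sum: "v $ 1 ^ d + v $ 2 ^ d + v $ 3 ^ d = 0" using True by (simp add: fermat_def)
  have "(v $ 1 ^ d + v $ 2 ^ d + v $ 3 ^ d) / v $ 3 ^ d = 0" using sum by simp
  then have "a ^ d + b ^ d + 1 = 0"
    using nz(3) by (simp add: a_def b_def power_divide add_divide_distrib)
  then interpret fermat_point d a b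
    by unfold_locales (use assms nz in \<open>auto simp: a_def b_def\<close>)
  have "vec.span {v} = vec.span {v $ 3 *s vector [a, b, 1]}"
    using nz by (intro arg_cong[of _ _ "\<lambda>x. vec.span {x}"]) (auto simp: vec_eq_iff forall_3 a_def b_def)
  then have "vec.span {v} = p" using span_scale nz(3) by simp
  then have "sextactic_point (fermat d) (vec.span {v}) \<longleftrightarrow> a ^ d = b ^ d \<or> a ^ d = 1 \<or> b ^ d = 1"
    using sextactic_point_iff[OF assms(1)] by simp
  also have "\<dots> \<longleftrightarrow> v $ 1 ^ d = v $ 2 ^ d \<or> v $ 1 ^ d = v $ 3 ^ d \<or> v $ 2 ^ d = v $ 3 ^ d"
    using nz by (simp add: a_def b_def power_divide)
  finally show ?thesis using True sum by blast
next
  case False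
  then have "\<not> sextactic_point (fermat d) (vec.span {v})"
    using inflection_point_coordinate_zero[OF assms] subspace_zero_locus_iff[OF form_fermat assms(2)]
    unfolding sextactic_point_def by blast
  moreover have "\<not> ((\<forall>i. v $ i \<noteq> 0) \<and> v $ 1 ^ d + v $ 2 ^ d + v $ 3 ^ d = 0)"
    using False by (auto simp: fermat_def)
  ultimately show ?thesis by blast
qed

text \<open>For \<open>x\<^sup>d + y\<^sup>d + z\<^sup>d = 0\<close> the condition says that the coordinates other than the \<open>i\<close>-th have equal
  \<open>d\<close>-th powers.\<close>

definition cluster :: "nat \<Rightarrow> 3 \<Rightarrow> (complex ^ 3) set set" where
  "cluster d i = {p \<in> proj_plane. \<forall>v\<in>p. \<forall>j. j \<noteq> i \<longrightarrow> v $ i ^ d = - 2 * v $ j ^ d}"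

lemma span_in_proj_plane: "v \<noteq> 0 \<Longrightarrow> vec.span {v} \<in> proj_plane"
  using proj_plane_iff by blast

lemma span_in_cluster_iff:
  assumes "v \<noteq> 0"
  shows "vec.span {v} \<in> cluster d i \<longleftrightarrow> (\<forall>j. j \<noteq> i \<longrightarrow> v $ i ^ d = - 2 * v $ j ^ d)"
proof
  assume "vec.span {v} \<in> cluster d i"
  moreover have "v \<in> vec.span {v}" by (simp add: vec.span_base)
  ultimately show "\<forall>j. j \<noteq> i \<longrightarrow> v $ i ^ d = - 2 * v $ j ^ d"
    unfolding cluster_def by blast
next
  assume "\<forall>j. j \<noteq> i \<longrightarrow> v $ i ^ d = - 2 * v $ j ^ d"
  then show "vec.span {v} \<in> cluster d i"
    unfolding cluster_def using span_in_proj_plane[OF assms]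
    by (auto simp: vec.span_singleton power_mult_distrib)
qed

lemma disjoint_clusters:
  assumes "i \<noteq> j" "d > 0"
  shows "cluster d i \<inter> cluster d j = {}"
proof (rule ccontr)
  assume "cluster d i \<inter> cluster d j \<noteq> {}"
  then obtain p where p: "p \<in> cluster d i" "p \<in> cluster d j" by blast
  then have "p \<in> proj_plane" by (simp add: cluster_def)
  then obtain v where v: "v \<noteq> 0" "p = vec.span {v}" by (rule proj_planeE)
  have i: "v $ i ^ d = - 2 * v $ k ^ d" if "k \<noteq> i" for k
    using p(1) that v span_in_cluster_iff by blast
  have j: "v $ j ^ d = - 2 * v $ k ^ d" if "k \<noteq> j" for k
    using p(2) that v span_in_cluster_iff by blast
  have "v $ i ^ d = 4 * v $ i ^ d" using i[of j] j[of i] assms(1) by simp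
  then have "v $ i ^ d = 0" by simp
  then have "v $ k ^ d = 0" for k using i[of k] by (cases "k = i") auto
  then have "v = 0" using assms(2) by (simp add: vec_eq_iff)
  with v(1) show False by simp
qed

lemma sextactic_points_eq:
  assumes "d \<ge> 3"
  shows "{p. sextactic_point (fermat d) p} = (\<Union>i. cluster d i)"
proof -
  have "sextactic_point (fermat d) p \<longleftrightarrow> p \<in> (\<Union>i. cluster d i)" if p: "p \<in> proj_plane" for p
  proof -
    obtain v where v: "v \<noteq> 0" "p = vec.span {v}" using p by (rule proj_planeE)
    define x y z where "x = v $ 1 ^ d" and "y = v $ 2 ^ d" and "z = v $ 3 ^ d"
    have zero: "v $ 1 = 0 \<longleftrightarrow> x = 0" "v $ 2 = 0 \<longleftrightarrow> y = 0" "v $ 3 = 0 \<longleftrightarrow> z = 0"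
      using assms by (simp_all add: x_def y_def z_def)
    have nz: "x \<noteq> 0 \<or> y \<noteq> 0 \<or> z \<noteq> 0"
      using v(1) zero by (auto simp: vec_eq_iff forall_3)
    have "p \<in> (\<Union>i. cluster d i) \<longleftrightarrow> (\<exists>i. \<forall>j. j \<noteq> i \<longrightarrow> v $ i ^ d = - 2 * v $ j ^ d)"
      unfolding v(2) using span_in_cluster_iff[OF v(1)] by blast
    \<comment> \<open>The existential is rewritten as a negated universal so that
      \<open>forall_3\<close> can enumerate the indices.\<close>
    also have "\<dots> \<longleftrightarrow> (x = - 2 * y \<and> x = - 2 * z) \<or> (y = - 2 * x \<and> y = - 2 * z) \<or> (z = - 2 * x \<and> z = - 2 * y)"
      unfolding x_def y_def z_def
      by (subst not_not[symmetric], subst not_ex, subst forall_3, subst forall_3, subst forall_3, subst forall_3) auto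
    also have "\<dots> \<longleftrightarrow> (x \<noteq> 0 \<and> y \<noteq> 0 \<and> z \<noteq> 0) \<and> x + y + z = 0 \<and> (x = y \<or> x = z \<or> y = z)" (is "?l \<longleftrightarrow> ?r")
    proof
      assume ?l
      then show ?r using nz by (elim disjE conjE) auto
    next
      assume r: ?r
      then have "z = - x - y" by (simp add: algebra_simps eq_neg_iff_add_eq_0)
      with r show ?l by auto
    qed
    also have "\<dots> \<longleftrightarrow> sextactic_point (fermat d) p"
      unfolding v(2) sextactic_point_fermat_iff[OF assms v(1)] forall_3 zero
      by (simp add: x_def y_def z_def)
    finally show ?thesis by simp
  qed
  moreover have "p \<in> proj_plane" if "sextactic_point (fermat d) p" for p
    using that by (simp add: sextactic_point_def zero_locus_def)
  moreover have "p \<in> proj_plane" if "p \<in> (\<Union>i. cluster d i)" for p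
    using that by (auto simp: cluster_def)
  ultimately show ?thesis by blast
qed

section \<open>Coordinate permutations of the clusters\<close>

lemma permute_coords_span:
  "permute_coords \<sigma> (vec.span {v}) = vec.span {\<chi> i. v $ \<sigma> i}"
proof -
  have "(\<chi> i. (k *s v) $ \<sigma> i) = k *s (\<chi> i. v $ \<sigma> i)" for k
    by (simp add: vec_eq_iff)
  then show ?thesis
    unfolding permute_coords_def vec.span_singleton image_image by simp
qed

lemma inj_permute_coords:
  assumes "bij \<sigma>"
  shows "inj (permute_coords \<sigma>)"
proof -
  have "inj (\<lambda>v :: complex ^ 3. \<chi> i. v $ \<sigma> i)"
  proof (rule injI)
    fix v w :: "complex ^ 3"
    assume "(\<chi> i. v $ \<sigma> i) = (\<chi> i. w $ \<sigma> i)"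
    then have "v $ \<sigma> i = w $ \<sigma> i" for i by (metis vec_lambda_beta)
    then have "v $ j = w $ j" for j using assms by (metis bij_pointE)
    then show "v = w" by (simp add: vec_eq_iff)
  qed
  then show ?thesis unfolding permute_coords_def by (intro injI) (simp add: inj_image_eq_iff)
qed

text \<open>Coordinate \<open>i\<close> of the permuted vector is coordinate
  \<open>\<sigma> i\<close> of the original, so the distinguished index moves from
  \<open>\<sigma> i\<close> to \<open>i\<close>.\<close>

lemma permute_coords_cluster:
  assumes "bij \<sigma>"
  shows "permute_coords \<sigma> ` cluster d (\<sigma> i) = cluster d i"
proof -
  have *: "vec.span {\<chi> i. v $ \<sigma> i} \<in> cluster d i \<longleftrightarrow> vec.span {v} \<in> cluster d (\<sigma> i)"
    "(\<chi> i. v $ \<sigma> i) \<noteq> 0" if v: "v \<noteq> 0" for v :: "complex ^ 3"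
  proof -
    obtain j where "v $ j \<noteq> 0" using v by (metis vec_eq_iff zero_index)
    moreover obtain k where "\<sigma> k = j" using assms by (metis bij_pointE)
    ultimately have "(\<chi> i. v $ \<sigma> i) $ k \<noteq> 0" by simp
    then show nz: "(\<chi> i. v $ \<sigma> i) \<noteq> 0" by (metis zero_index)
    show "vec.span {\<chi> i. v $ \<sigma> i} \<in> cluster d i \<longleftrightarrow> vec.span {v} \<in> cluster d (\<sigma> i)"
      unfolding span_in_cluster_iff[OF nz] span_in_cluster_iff[OF v]
      using assms by (simp, metis bij_pointE)
  qed
  show ?thesis
  proof (intro equalityI subsetI)
    fix p assume "p \<in> permute_coords \<sigma> ` cluster d (\<sigma> i)"
    then obtain q where q: "q \<in> cluster d (\<sigma> i)" "p = permute_coords \<sigma> q" by blast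
    then have "q \<in> proj_plane" by (simp add: cluster_def)
    then obtain v where "v \<noteq> 0" "q = vec.span {v}" by (rule proj_planeE)
    then show "p \<in> cluster d i" using q * permute_coords_span by simp
  next
    fix p assume p: "p \<in> cluster d i"
    then have "p \<in> proj_plane" by (simp add: cluster_def)
    then obtain w where w: "w \<noteq> 0" "p = vec.span {w}" by (rule proj_planeE)
    define v where "v = (\<chi> i. w $ inv \<sigma> i)"
    have wv: "w = (\<chi> i. v $ \<sigma> i)" using assms by (simp add: v_def vec_eq_iff bij_is_inj)
    then have "v \<noteq> 0" using w(1) by (auto simp: vec_eq_iff)
    then have "vec.span {v} \<in> cluster d (\<sigma> i)" "p = permute_coords \<sigma> (vec.span {v})"
      using *(1)[of v] p w(2) wv permute_coords_span by simp_all
    then show "p \<in> permute_coords \<sigma> ` cluster d (\<sigma> i)" by blast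
  qed
qed

section \<open>Roots of unity\<close>

definition nth_roots :: "nat \<Rightarrow> complex \<Rightarrow> complex set" where
  "nth_roots d c = {w. w ^ d = c}"

lemma card_nth_roots_eq: "c \<noteq> 0 \<Longrightarrow> d > 0 \<Longrightarrow> card (nth_roots d c) = d"
  unfolding nth_roots_def by (rule card_nth_roots)

lemma finite_nth_roots_eq: "c \<noteq> 0 \<Longrightarrow> d > 0 \<Longrightarrow> finite (nth_roots d c)"
  unfolding nth_roots_def by (rule finite_nth_roots)

lemma primitive_root_of_unity_inj:
  assumes "primitive_root_of_unity n w" "i < n" "j < n" "w ^ i = w ^ j"
  shows "i = j"
proof -
  have w: "w \<noteq> 0" using assms(1) by (auto simp: primitive_root_of_unity_def power_0_left)
  have "\<not> i < j" if "i < n" "j < n" "w ^ i = w ^ j" for i j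
  proof
    assume "i < j"
    then have "w ^ (j - i) * w ^ i = w ^ j" using power_add[of w "j - i" i] by simp
    then have "w ^ (j - i) * w ^ i = w ^ i" using that by simp
    then have "w ^ (j - i) = 1" using w by simp
    then show False using assms(1) \<open>i < j\<close> that by (auto simp: primitive_root_of_unity_def)
  qed
  from this[of i j] this[of j i] assms(2-4) show ?thesis by simp
qed

lemma nth_roots_1:
  assumes "primitive_root_of_unity d \<zeta>"
  shows "nth_roots d 1 = (\<lambda>j. \<zeta> ^ j) ` {..<d}"
proof -
  have d: "d > 0" "\<zeta> ^ d = 1" using assms by (auto simp: primitive_root_of_unity_def)
  have "(\<zeta> ^ j) ^ d = 1" for j
    by (metis d(2) mult.commute power_mult power_one)
  then have sub: "(\<lambda>j. \<zeta> ^ j) ` {..<d} \<subseteq> nth_roots d 1" by (auto simp: nth_roots_def)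
  have "inj_on (\<lambda>j. \<zeta> ^ j) {..<d}"
    using primitive_root_of_unity_inj[OF assms] by (auto simp: inj_on_def)
  then have "card ((\<lambda>j. \<zeta> ^ j) ` {..<d}) = card (nth_roots d 1)"
    using d(1) by (simp add: card_image card_nth_roots_eq)
  then show ?thesis
    using card_subset_eq[OF finite_nth_roots_eq[OF one_neq_zero d(1)] sub] by simp
qed

text \<open>\<open>u ^ d\<close> squares to 1 without being 1, hence is \<open>- 1\<close>, and odd
  powers keep that sign. The \<open>d\<close> odd exponents give distinct roots, so the number of
  roots leaves no others.\<close>

lemma nth_roots_minus_2:
  assumes "primitive_root_of_unity (2 * d) u"
  shows "nth_roots d (- 2) =
    (\<lambda>k. u powi (- int k) * complex_of_real (root d 2)) ` {k. odd k \<and> 0 < k \<and> k < 2 * d}"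
    (is "_ = ?f ` ?K")
proof -
  have d: "d > 0" "u ^ (2 * d) = 1" "u ^ d \<noteq> 1" using assms by (auto simp: primitive_root_of_unity_def)
  then have u: "u \<noteq> 0" by (auto simp: power_0_left)
  have "(u ^ d)\<^sup>2 = 1" using d(2) by (simp add: power_mult[symmetric] mult.commute)
  then have ud: "u ^ d = - 1" using d(3) by (simp add: power2_eq_1_iff)
  have r: "complex_of_real (root d 2) ^ d = 2" "complex_of_real (root d 2) \<noteq> 0"
    using d(1) by (simp_all flip: of_real_power)
  have f: "?f k = inverse (u ^ k) * complex_of_real (root d 2)" for k
    by (simp add: power_int_minus)
  have "?f k ^ d = - 2" if "odd k" for k
  proof -
    have "(u ^ k) ^ d = (u ^ d) ^ k" by (simp add: power_mult[symmetric] mult.commute)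
    then have "(u ^ k) ^ d = - 1" using ud that by simp
    then show ?thesis unfolding f by (simp add: power_mult_distrib power_inverse r)
  qed
  then have sub: "?f ` ?K \<subseteq> nth_roots d (- 2)" by (auto simp: nth_roots_def)
  have inj: "inj_on ?f ?K"
    unfolding f using primitive_root_of_unity_inj[OF assms] r(2) by (auto simp: inj_on_def)
  have "?K = (\<lambda>i. 2 * i + 1) ` {..<d}"
    by (auto elim!: oddE)
  then have "card ?K = d" by (simp add: card_image inj_on_def)
  then have "card (?f ` ?K) = card (nth_roots d (- 2))"
    unfolding card_image[OF inj] using d(1) by (simp add: card_nth_roots_eq)
  then show ?thesis
    using card_subset_eq[OF finite_nth_roots_eq[OF _ d(1)] sub] by simp
qed

lemma hpoint_nonzero: "a \<noteq> 0 \<or> b \<noteq> 0 \<or> c \<noteq> 0 \<Longrightarrow> vector [a, b, c] \<noteq> (0 :: complex ^ 3)"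
  by (auto simp: vec_eq_iff forall_3)

lemma hpoint_eq_iff: "hpoint a 1 b = hpoint a' 1 b' \<longleftrightarrow> a = a' \<and> b = b'"
proof
  assume "hpoint a 1 b = hpoint a' 1 b'"
  moreover have "vector [a', 1, b'] \<noteq> (0 :: complex ^ 3)" by (rule hpoint_nonzero) simp
  ultimately obtain k where k: "vector [a', 1, b'] = k *s (vector [a, 1, b] :: complex ^ 3)"
    unfolding hpoint_def by (elim span_eqE) blast
  from arg_cong[OF k, of "\<lambda>v. v $ 1"] arg_cong[OF k, of "\<lambda>v. v $ 2"] arg_cong[OF k, of "\<lambda>v. v $ 3"]
  show "a = a' \<and> b = b'" by simp
qed simp

lemma span_eq_hpoint:
  assumes "v $ 2 \<noteq> 0"
  shows "vec.span {v} = hpoint (v $ 1 / v $ 2) 1 (v $ 3 / v $ 2)"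
proof -
  have "v = v $ 2 *s vector [v $ 1 / v $ 2, 1, v $ 3 / v $ 2]"
    using assms by (simp add: vec_eq_iff forall_3)
  then show ?thesis unfolding hpoint_def using span_scale[OF assms] by metis
qed

text \<open>A point of the cluster with \<open>y = 0\<close> would have all coordinates 0. So
  \<open>y\<close> scales to 1, and the other two coordinates are independently chosen
  roots.\<close>

lemma cluster_3:
  assumes "d > 0"
  shows "cluster d 3 = (\<lambda>(r, q). hpoint r 1 q) ` (nth_roots d 1 \<times> nth_roots d (- 2))"
proof (intro equalityI subsetI)
  fix p assume p: "p \<in> cluster d 3"
  then have "p \<in> proj_plane" by (simp add: cluster_def)
  then obtain v where v: "v \<noteq> 0" "p = vec.span {v}" by (rule proj_planeE)
  then have "\<forall>j. j \<noteq> 3 \<longrightarrow> v $ 3 ^ d = - 2 * v $ j ^ d" using p span_in_cluster_iff by blast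
  then have eq: "v $ 3 ^ d = - 2 * v $ 1 ^ d" "v $ 3 ^ d = - 2 * v $ 2 ^ d" by simp_all
  have nz: "v $ 2 \<noteq> 0"
  proof
    assume "v $ 2 = 0"
    then have 2: "v $ 2 ^ d = 0" using assms by simp
    have "v $ 3 ^ d = 0" using eq(2) unfolding 2 by simp
    moreover from this have "v $ 1 ^ d = 0" using eq(1) by simp
    moreover note 2
    ultimately show False using v(1) by (simp add: vec_eq_iff forall_3)
  qed
  have "v $ 1 / v $ 2 \<in> nth_roots d 1" "v $ 3 / v $ 2 \<in> nth_roots d (- 2)"
  proof -
    have "v $ 2 ^ d \<noteq> 0" using nz by simp
    moreover have "v $ 1 ^ d = v $ 2 ^ d" using eq by simp
    ultimately show "v $ 1 / v $ 2 \<in> nth_roots d 1" "v $ 3 / v $ 2 \<in> nth_roots d (- 2)"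
      using eq(2) by (simp_all add: nth_roots_def power_divide)
  qed
  then show "p \<in> (\<lambda>(r, q). hpoint r 1 q) ` (nth_roots d 1 \<times> nth_roots d (- 2))"
    unfolding v(2) span_eq_hpoint[OF nz] by blast
next
  fix p assume "p \<in> (\<lambda>(r, q). hpoint r 1 q) ` (nth_roots d 1 \<times> nth_roots d (- 2))"
  then obtain r q where "r ^ d = 1" "q ^ d = - 2" "p = hpoint r 1 q" by (auto simp: nth_roots_def)
  then show "p \<in> cluster d 3"
    unfolding hpoint_def by (simp add: span_in_cluster_iff hpoint_nonzero forall_3)
qed

lemma card_cluster:
  assumes "d > 0"
  shows "card (cluster d i) = d\<^sup>2"
proof -
  \<comment> \<open>The transposition of \<open>i\<close> and 3, which for \<open>i = 3\<close> is
    the identity, reduces the count to \<open>cluster d 3\<close>.\<close>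
  define \<sigma> :: "3 \<Rightarrow> 3" where "\<sigma> = id(i := 3, 3 := i)"
  have \<sigma>: "bij \<sigma>" by (rule involuntory_imp_bij) (auto simp: \<sigma>_def)
  have "inj_on (\<lambda>(r, q). hpoint r 1 q) (nth_roots d 1 \<times> nth_roots d (- 2))"
    by (auto simp: inj_on_def hpoint_eq_iff)
  then have "card (cluster d 3) = d\<^sup>2"
    unfolding cluster_3[OF assms]
    using assms by (simp add: card_image card_cartesian_product card_nth_roots_eq power2_eq_square)
  moreover have "\<sigma> i = 3" by (auto simp: \<sigma>_def)
  then have "cluster d i = permute_coords \<sigma> ` cluster d 3"
    using permute_coords_cluster[OF \<sigma>, of d i] by simp
  ultimately show ?thesis
    using card_image[OF inj_on_subset[OF inj_permute_coords[OF \<sigma>] subset_UNIV]] by simp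
qed

lemma s_cluster_eq:
  assumes "primitive_root_of_unity (2 * d) u" "primitive_root_of_unity d \<zeta>"
  shows "s_cluster d u \<zeta> = cluster d 3"
proof -
  have "d > 0" using assms(2) by (simp add: primitive_root_of_unity_def)
  show ?thesis
    unfolding cluster_3[OF \<open>d > 0\<close>] nth_roots_1[OF assms(2)] nth_roots_minus_2[OF assms(1)]
      s_cluster_def s_point_def by (auto simp: image_iff)
qed

text \<open>The image of the cluster depends only on the index that \<open>\<sigma>\<close> sends to
  3, so six permutations yield three sets.\<close>

lemma clusters_eq:
  assumes "primitive_root_of_unity (2 * d) u" "primitive_root_of_unity d \<zeta>"
  shows "clusters d u \<zeta> = range (cluster d)"
proof (intro equalityI subsetI)
  fix C assume "C \<in> clusters d u \<zeta>"
  then obtain \<sigma> where \<sigma>: "bij \<sigma>" "C = permute_coords \<sigma> ` cluster d 3"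
    unfolding clusters_def s_cluster_eq[OF assms] by blast
  obtain i where "\<sigma> i = 3" using \<sigma>(1) by (metis bij_pointE)
  then show "C \<in> range (cluster d)"
    using permute_coords_cluster[OF \<sigma>(1), of d i] \<sigma>(2) by simp
next
  fix C assume "C \<in> range (cluster d)"
  then obtain i where C: "C = cluster d i" by blast
  define \<sigma> :: "3 \<Rightarrow> 3" where "\<sigma> = id(i := 3, 3 := i)"
  have \<sigma>: "bij \<sigma>" by (rule involuntory_imp_bij) (auto simp: \<sigma>_def)
  have "\<sigma> i = 3" by (auto simp: \<sigma>_def)
  then have "C = permute_coords \<sigma> ` cluster d 3"
    using permute_coords_cluster[OF \<sigma>, of d i] C by simp
  then show "C \<in> clusters d u \<zeta>"
    unfolding clusters_def s_cluster_eq[OF assms] using \<sigma> by blast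
qed

text \<open>Equal clusters at different indices would be disjoint from themselves, hence empty,
  against the count \<open>d\<^sup>2\<close>.\<close>

lemma inj_cluster: "d > 0 \<Longrightarrow> inj (cluster d)"
  using disjoint_clusters card_cluster
  by (intro injI) (metis Int_absorb card.empty power2_eq_square mult_is_0 less_numeral_extra(3))

lemma card_clusters: "d > 0 \<Longrightarrow> card (range (cluster d)) = 3"
  by (simp add: card_image inj_cluster)

lemma disjoint_range_cluster: "d > 0 \<Longrightarrow> disjoint (range (cluster d))"
  unfolding disjoint_def by clarify (metis disjoint_clusters)

lemma card_sextactic_points:
  assumes "d > 0"
  shows "card (\<Union>i. cluster d i) = 3 * d\<^sup>2"
proof -
  have "finite (cluster d i)" for i
    using card_cluster[OF assms, of i] assms by (intro card_ge_0_finite) simp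
  then have "card (\<Union>i. cluster d i) = (\<Sum>i\<in>UNIV. card (cluster d i))"
    using disjoint_clusters[OF _ assms] by (intro card_UN_disjoint) auto
  then show ?thesis by (simp add: card_cluster[OF assms])
qed

section \<open>The arrangement of lines\<close>

definition coordinate_line :: "3 \<Rightarrow> 3 \<Rightarrow> complex \<Rightarrow> (complex ^ 3) set set" where
  "coordinate_line i j w = {p \<in> proj_plane. \<forall>v\<in>p. v $ i = w * v $ j}"

lemma span_in_coordinate_line_iff:
  assumes "v \<noteq> 0"
  shows "vec.span {v} \<in> coordinate_line i j w \<longleftrightarrow> v $ i = w * v $ j"
proof
  assume "vec.span {v} \<in> coordinate_line i j w"
  moreover have "v \<in> vec.span {v}" by (simp add: vec.span_base)
  ultimately show "v $ i = w * v $ j" unfolding coordinate_line_def by blast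
next
  assume "v $ i = w * v $ j"
  then show "vec.span {v} \<in> coordinate_line i j w"
    unfolding coordinate_line_def using span_in_proj_plane[OF assms]
    by (auto simp: vec.span_singleton)
qed

lemma hpoint_in_coordinate_line_iff:
  assumes "a \<noteq> 0 \<or> b \<noteq> 0 \<or> c \<noteq> 0"
  shows "hpoint a b c \<in> coordinate_line i j w \<longleftrightarrow>
    (vector [a, b, c] :: complex ^ 3) $ i = w * (vector [a, b, c] :: complex ^ 3) $ j"
  unfolding hpoint_def by (rule span_in_coordinate_line_iff[OF hpoint_nonzero[OF assms]])

lemma proj_plane_subset_eqI:
  assumes "P \<subseteq> proj_plane" "Q \<subseteq> proj_plane"
    and "\<And>v. v \<noteq> 0 \<Longrightarrow> vec.span {v} \<in> P \<longleftrightarrow> vec.span {v} \<in> Q"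
  shows "P = Q"
proof -
  have "p \<in> P \<longleftrightarrow> p \<in> Q" if p: "p \<in> proj_plane" for p
  proof -
    obtain v where "v \<noteq> 0" "p = vec.span {v}" using p by (rule proj_planeE)
    then show ?thesis using assms(3) by simp
  qed
  then show ?thesis using assms(1,2) by blast
qed

lemma coordinate_line_eq_zero_locus:
  assumes "i \<noteq> j"
  shows "coordinate_line i j w = zero_locus (PV i - PC w * PV j)"
    and "is_line (coordinate_line i j w)"
proof -
  have f: "form 1 (PV i - PC w * PV j)" by (intro form_diff form_PV form_PC_mult)
  show eq: "coordinate_line i j w = zero_locus (PV i - PC w * PV j)"
  proof (rule proj_plane_subset_eqI)
    fix v :: "complex ^ 3" assume v: "v \<noteq> 0"
    show "vec.span {v} \<in> coordinate_line i j w \<longleftrightarrow> vec.span {v} \<in> zero_locus (PV i - PC w * PV j)"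
      unfolding span_in_coordinate_line_iff[OF v] subspace_zero_locus_iff[OF f v] by simp
  qed (auto simp: coordinate_line_def zero_locus_def)
  have "eval3 (PV i - PC w * PV j) (axis i 1) = 1"
    using assms by (simp add: axis_def)
  then have "PV i - PC w * PV j \<noteq> 0" by (metis eval3_hom(1) zero_neq_one)
  then show "is_line (coordinate_line i j w)"
    unfolding is_line_def eq using f by blast
qed

text \<open>Covers the three line families at once, with \<open>c = 1\<close> for \<open>B_z\<close>
  and \<open>c = - 2\<close> for \<open>M_x\<close> and \<open>N_y\<close>.\<close>

locale binomial_form =
  fixes i j :: 3 and c :: complex and d :: nat and G :: poly3
  assumes ij: "i \<noteq> j" and c: "c \<noteq> 0" and d: "d > 0" and form: "form d G"
    and eval: "\<And>v. eval3 G v = v $ i ^ d - c * v $ j ^ d"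
begin

lemma zero_locus_iff: "v \<noteq> 0 \<Longrightarrow> vec.span {v} \<in> zero_locus G \<longleftrightarrow> v $ i ^ d = c * v $ j ^ d"
  using subspace_zero_locus_iff[OF form] eval by simp

text \<open>The inclusion from left to right evaluates a line of the zero locus at two well-chosen
  points of it, each of which must satisfy the equation.\<close>

lemma lines: "lines_of G = coordinate_line i j ` nth_roots d c"
proof (intro equalityI subsetI)
  fix l assume "l \<in> coordinate_line i j ` nth_roots d c"
  then obtain w where w: "l = coordinate_line i j w" "w ^ d = c" by (auto simp: nth_roots_def)
  have "p \<in> zero_locus G" if "p \<in> l" for p
  proof -
    have "p \<in> proj_plane" using that w by (simp add: coordinate_line_def)
    then obtain v where v: "v \<noteq> 0" "p = vec.span {v}" by (rule proj_planeE)
    then have "v $ i = w * v $ j" using that w span_in_coordinate_line_iff by simp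
    then show ?thesis using v zero_locus_iff w(2) by (simp add: power_mult_distrib)
  qed
  then show "l \<in> lines_of G"
    unfolding lines_of_def using coordinate_line_eq_zero_locus(2)[OF ij] w by blast
next
  fix l assume "l \<in> lines_of G"
  then obtain L where L: "L \<noteq> 0" "form 1 L" "l = zero_locus L" "l \<subseteq> zero_locus G"
    unfolding lines_of_def is_line_def by blast
  obtain a1 a2 a3 where L_eq: "L = PC a1 * PX + PC a2 * PY + PC a3 * PZ"
    using form_1_cases[OF L(2)] .
  define \<alpha> :: "complex ^ 3" where "\<alpha> = vector [a1, a2, a3]"
  have evL: "eval3 L v = (\<Sum>m\<in>UNIV. \<alpha> $ m * v $ m)" for v
    by (simp add: L_eq \<alpha>_def sum_3)
  have "\<alpha> \<noteq> 0"
    using L(1) unfolding L_eq \<alpha>_def by (auto simp: vec_eq_iff forall_3)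
  have on_G: "v $ i ^ d = c * v $ j ^ d" if "v \<noteq> 0" "(\<Sum>m\<in>UNIV. \<alpha> $ m * v $ m) = 0" for v
    using L(3,4) subspace_zero_locus_iff[OF L(2) that(1)] evL that zero_locus_iff[OF that(1)] by auto
  obtain k where k: "k \<noteq> i" "k \<noteq> j" "UNIV = {i, j, k}"
  proof -
    have "card (UNIV - {i, j}) = 1"
      using ij by (subst card_Diff_subset) auto
    then obtain k where "UNIV - {i, j} = {k}" by (rule card_1_singletonE)
    then show ?thesis using that by blast
  qed
  have sum: "(\<Sum>m\<in>UNIV. f m) = f i + f j + f k" for f :: "3 \<Rightarrow> complex"
    unfolding k(3) using k(1,2) ij by (auto simp: add.assoc)
  have "\<alpha> $ k = 0"
  proof (rule ccontr)
    assume nz: "\<alpha> $ k \<noteq> 0"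
    \<comment> \<open>If the third variable occurred in the equation of the line, this point with
      \<open>v $ i = 1\<close> and \<open>v $ j = 0\<close> would lie on it, yet off the zero
      locus.\<close>
    define v :: "complex ^ 3" where "v = (\<chi> m. if m = i then 1 else if m = j then 0 else - \<alpha> $ i / \<alpha> $ k)"
    have v: "v $ i = 1" "v $ j = 0" "v $ k = - \<alpha> $ i / \<alpha> $ k" using ij k by (simp_all add: v_def)
    then have "v \<noteq> 0" by (metis zero_index zero_neq_one)
    moreover have "(\<Sum>m\<in>UNIV. \<alpha> $ m * v $ m) = 0" unfolding sum v using nz by simp
    ultimately have "(1::complex) ^ d = c * 0 ^ d" using on_G v by metis
    then show False using d by (simp add: power_0_left)
  qed
  then have nz: "\<alpha> $ i \<noteq> 0 \<or> \<alpha> $ j \<noteq> 0"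
    using \<open>\<alpha> \<noteq> 0\<close> k(3) by (metis (full_types) UNIV_I empty_iff insert_iff vec_eq_iff zero_index)
  \<comment> \<open>The point of the line with third coordinate 0; its membership in the zero locus
    makes \<open>- \<alpha> $ j / \<alpha> $ i\<close> a \<open>d\<close>-th root of
    \<open>c\<close>.\<close>
  define v :: "complex ^ 3" where "v = (\<chi> m. if m = i then \<alpha> $ j else if m = j then - \<alpha> $ i else 0)"
  have v: "v $ i = \<alpha> $ j" "v $ j = - \<alpha> $ i" "v $ k = 0" using ij k by (simp_all add: v_def)
  have "v \<noteq> 0" using nz v by (metis neg_equal_0_iff_equal zero_index)
  moreover have "(\<Sum>m\<in>UNIV. \<alpha> $ m * v $ m) = 0" unfolding sum v by simp
  ultimately have eq: "\<alpha> $ j ^ d = c * (- \<alpha> $ i) ^ d" using on_G v by metis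
  then have nzi: "\<alpha> $ i \<noteq> 0" using nz c d by (auto simp: power_0_left)
  define w where "w = - \<alpha> $ j / \<alpha> $ i"
  have w': "w = \<alpha> $ j / (- \<alpha> $ i)" by (simp add: w_def)
  have "w ^ d = c"
    unfolding w' power_divide eq using nzi by simp
  moreover have "l = coordinate_line i j w"
  proof (rule proj_plane_subset_eqI)
    fix v :: "complex ^ 3" assume v: "v \<noteq> 0"
    have "vec.span {v} \<in> l \<longleftrightarrow> \<alpha> $ i * v $ i + \<alpha> $ j * v $ j = 0"
      unfolding L(3) subspace_zero_locus_iff[OF L(2) v] evL sum \<open>\<alpha> $ k = 0\<close> by simp
    also have "\<dots> \<longleftrightarrow> v $ i = w * v $ j"
      using nzi by (simp add: w_def field_simps eq_neg_iff_add_eq_0)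
    finally show "vec.span {v} \<in> l \<longleftrightarrow> vec.span {v} \<in> coordinate_line i j w"
      unfolding span_in_coordinate_line_iff[OF v] .
  qed (auto simp: L(3) zero_locus_def coordinate_line_def)
  ultimately show "l \<in> coordinate_line i j ` nth_roots d c" by (auto simp: nth_roots_def)
qed

lemma inj_coordinate_line: "inj (coordinate_line i j)"
proof (rule injI)
  fix w w' assume eq: "coordinate_line i j w = coordinate_line i j w'"
  define v :: "complex ^ 3" where "v = (\<chi> m. if m = i then w else 1)"
  have v: "v $ i = w" "v $ j = 1" using ij by (simp_all add: v_def)
  then have "v \<noteq> 0" by (metis zero_index zero_neq_one)
  then show "w = w'"
    using span_in_coordinate_line_iff[of v i j w] span_in_coordinate_line_iff[of v i j w'] eq v by simp
qed

lemma card_lines: "card (lines_of G) = d"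
  unfolding lines using card_nth_roots_eq[OF c d] inj_on_subset[OF inj_coordinate_line subset_UNIV]
  by (simp add: card_image)

lemma Union_lines: "\<Union>(lines_of G) = zero_locus G"
proof (rule proj_plane_subset_eqI)
  fix v :: "complex ^ 3" assume v: "v \<noteq> 0"
  have "(\<exists>w\<in>nth_roots d c. v $ i = w * v $ j) \<longleftrightarrow> v $ i ^ d = c * v $ j ^ d"
  proof
    assume eq: "v $ i ^ d = c * v $ j ^ d"
    \<comment> \<open>Some root is needed for the case \<open>v $ j = 0\<close>, where the point
      lies on every line of the family.\<close>
    obtain w where "w \<in> nth_roots d c"
      using card_nth_roots_eq[OF c d] d by (metis card.empty ex_in_conv less_irrefl)
    show "\<exists>w\<in>nth_roots d c. v $ i = w * v $ j"
    proof (cases "v $ j = 0")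
      case True
      then have "v $ i = 0" using eq d by (simp add: power_0_left)
      with True \<open>w \<in> nth_roots d c\<close> show ?thesis by auto
    next
      case False
      then have "v $ i / v $ j \<in> nth_roots d c" using eq by (simp add: nth_roots_def power_divide)
      moreover have "v $ i = v $ i / v $ j * v $ j" using False by simp
      ultimately show ?thesis by blast
    qed
  qed (auto simp: nth_roots_def power_mult_distrib)
  then show "vec.span {v} \<in> \<Union>(lines_of G) \<longleftrightarrow> vec.span {v} \<in> zero_locus G"
    unfolding lines zero_locus_iff[OF v] using span_in_coordinate_line_iff[OF v] by auto
qed (auto simp: lines coordinate_line_def zero_locus_def)

end

lemma form_two_mult: "form n P \<Longrightarrow> form n (2 * P)"
  by (simp only: mult_2 form_add)

lemma binomial_forms:
  assumes "d > 0"
  shows "binomial_form 1 2 1 d (B_z d)" "binomial_form 3 2 (- 2) d (M_x d)"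
    "binomial_form 3 1 (- 2) d (N_y d)"
  unfolding B_z_def M_x_def N_y_def
  by (unfold_locales; use assms in \<open>(simp; fail) |
      (intro form_diff form_add form_two_mult form_power1 form_PX form_PY form_PZ; fail)\<close>)+

definition "arrangement d =
  coordinate_line 1 2 ` nth_roots d 1 \<union> coordinate_line 3 2 ` nth_roots d (- 2) \<union>
  coordinate_line 3 1 ` nth_roots d (- 2)"

context
  fixes d :: nat
  assumes d: "d > 0"
begin

interpretation Bz: binomial_form 1 2 1 d "B_z d" by (rule binomial_forms[OF d])
interpretation Mx: binomial_form 3 2 "- 2" d "M_x d" by (rule binomial_forms[OF d])
interpretation Ny: binomial_form 3 1 "- 2" d "N_y d" by (rule binomial_forms[OF d])

lemma arrangement_eq: "lines_of (B_z d) \<union> lines_of (M_x d) \<union> lines_of (N_y d) = arrangement d"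
  unfolding arrangement_def Bz.lines Mx.lines Ny.lines ..

lemma card_lines_of: "\<forall>G\<in>{B_z d, M_x d, N_y d}. card (lines_of G) = d \<and> \<Union>(lines_of G) = zero_locus G"
  using Bz.card_lines Mx.card_lines Ny.card_lines Bz.Union_lines Mx.Union_lines Ny.Union_lines by blast

lemma nth_roots_nz: "w \<in> nth_roots d 1 \<Longrightarrow> w \<noteq> 0" "w \<in> nth_roots d (- 2) \<Longrightarrow> w \<noteq> 0"
  using d by (auto simp: nth_roots_def power_0_left)

section \<open>Incidences between the lines and the distinguished points\<close>

lemma vertex_in_line_iff:
  "hpoint 1 0 0 \<in> coordinate_line 1 2 w \<longleftrightarrow> False"
  "hpoint 1 0 0 \<in> coordinate_line 3 2 w \<longleftrightarrow> True"
  "hpoint 1 0 0 \<in> coordinate_line 3 1 w \<longleftrightarrow> w = 0"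
  "hpoint 0 1 0 \<in> coordinate_line 1 2 w \<longleftrightarrow> w = 0"
  "hpoint 0 1 0 \<in> coordinate_line 3 2 w \<longleftrightarrow> w = 0"
  "hpoint 0 1 0 \<in> coordinate_line 3 1 w \<longleftrightarrow> True"
  "hpoint 0 0 1 \<in> coordinate_line 1 2 w \<longleftrightarrow> True"
  "hpoint 0 0 1 \<in> coordinate_line 3 2 w \<longleftrightarrow> False"
  "hpoint 0 0 1 \<in> coordinate_line 3 1 w \<longleftrightarrow> False"
  by (simp_all add: hpoint_in_coordinate_line_iff)

lemma point_in_line_iff:
  "hpoint r 1 q \<in> coordinate_line 1 2 w \<longleftrightarrow> w = r"
  "hpoint r 1 q \<in> coordinate_line 3 2 w \<longleftrightarrow> w = q"
  "r \<noteq> 0 \<Longrightarrow> hpoint r 1 q \<in> coordinate_line 3 1 w \<longleftrightarrow> w = q / r"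
  by (auto simp: hpoint_in_coordinate_line_iff)

text \<open>The vertices separate the families: as the slopes are nonzero, each vertex lies on the
  lines of one family only.\<close>

lemma disjoint_families:
  "coordinate_line 1 2 ` nth_roots d 1 \<inter> coordinate_line 3 2 ` nth_roots d (- 2) = {}"
  "(coordinate_line 1 2 ` nth_roots d 1 \<union> coordinate_line 3 2 ` nth_roots d (- 2)) \<inter>
    coordinate_line 3 1 ` nth_roots d (- 2) = {}"
proof -
  have "coordinate_line 1 2 w \<noteq> coordinate_line 3 2 w'" for w w'
    using vertex_in_line_iff(7)[of w] vertex_in_line_iff(8)[of w'] by auto
  moreover have "coordinate_line 1 2 w \<noteq> coordinate_line 3 1 w'" for w w'
    using vertex_in_line_iff(7)[of w] vertex_in_line_iff(9)[of w'] by auto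
  moreover have "coordinate_line 3 2 w \<noteq> coordinate_line 3 1 w'" if "w' \<in> nth_roots d (- 2)" for w w'
    using vertex_in_line_iff(2)[of w] vertex_in_line_iff(3)[of w'] nth_roots_nz(2)[OF that] by auto
  ultimately show "coordinate_line 1 2 ` nth_roots d 1 \<inter> coordinate_line 3 2 ` nth_roots d (- 2) = {}"
    "(coordinate_line 1 2 ` nth_roots d 1 \<union> coordinate_line 3 2 ` nth_roots d (- 2)) \<inter>
      coordinate_line 3 1 ` nth_roots d (- 2) = {}"
    by blast+
qed

lemma card_arrangement: "card (arrangement d) = 3 * d"
proof -
  have fin: "finite (lines_of (B_z d))" "finite (lines_of (M_x d))" "finite (lines_of (N_y d))"
    using Bz.card_lines Mx.card_lines Ny.card_lines d by (auto intro: card_ge_0_finite)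
  show ?thesis
    unfolding arrangement_eq[symmetric]
    using disjoint_families unfolding Bz.lines[symmetric] Mx.lines[symmetric] Ny.lines[symmetric]
    by (simp add: card_Un_disjoint fin Bz.card_lines Mx.card_lines Ny.card_lines)
qed

text \<open>Each family has exactly one line through \<open>(r:1:q)\<close>, with slope
  \<open>r\<close>, \<open>q\<close> and \<open>q / r\<close> respectively; \<open>q / r\<close> is
  a root of \<open>- 2\<close> because \<open>r\<close> is a root of 1.\<close>

lemma ordinary_point_cluster:
  assumes "p \<in> cluster d 3"
  shows "ordinary_point (arrangement d) 3 p"
proof -
  obtain r q where rq: "r \<in> nth_roots d 1" "q \<in> nth_roots d (- 2)" "p = hpoint r 1 q"
    using assms unfolding cluster_3[OF d] by blast
  have r: "r \<noteq> 0" using nth_roots_nz rq by blast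
  have qr: "q / r \<in> nth_roots d (- 2)" using rq by (simp add: nth_roots_def power_divide)
  have "{l \<in> arrangement d. p \<in> l} = {coordinate_line 1 2 r, coordinate_line 3 2 q, coordinate_line 3 1 (q / r)}"
    unfolding arrangement_def rq(3) using rq qr by (auto simp: point_in_line_iff r)
  moreover have "card {coordinate_line 1 2 r, coordinate_line 3 2 q, coordinate_line 3 1 (q / r)} = 3"
    using disjoint_families rq qr by (subst card_insert_disjoint; auto)+
  ultimately show ?thesis
    using assms by (simp add: ordinary_point_def cluster_def)
qed

lemma ordinary_point_vertex:
  assumes "p \<in> {hpoint 1 0 0, hpoint 0 1 0, hpoint 0 0 1}"
  shows "ordinary_point (arrangement d) d p"
proof -
  have "{l \<in> arrangement d. hpoint 1 0 0 \<in> l} = coordinate_line 3 2 ` nth_roots d (- 2)"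
    "{l \<in> arrangement d. hpoint 0 1 0 \<in> l} = coordinate_line 3 1 ` nth_roots d (- 2)"
    "{l \<in> arrangement d. hpoint 0 0 1 \<in> l} = coordinate_line 1 2 ` nth_roots d 1"
    unfolding arrangement_def using nth_roots_nz by (auto simp: vertex_in_line_iff)
  then have "card {l \<in> arrangement d. p \<in> l} = d"
    using assms Bz.card_lines Mx.card_lines Ny.card_lines by (auto simp: Bz.lines Mx.lines Ny.lines)
  moreover have "p \<in> proj_plane"
    using assms by (auto simp: hpoint_def intro!: span_in_proj_plane hpoint_nonzero)
  ultimately show ?thesis by (simp add: ordinary_point_def)
qed

lemma card_cluster_line:
  assumes "l \<in> arrangement d"
  shows "card (cluster d 3 \<inter> l) = d"
proof -
  have inj: "inj_on (\<lambda>x. hpoint (f x) 1 (g x)) S" if "inj_on f S \<or> inj_on g S" for f g :: "complex \<Rightarrow> complex" and S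
    using that by (auto simp: inj_on_def hpoint_eq_iff)
  have r: "card (nth_roots d 1) = d" "card (nth_roots d (- 2)) = d" using d by (simp_all add: card_nth_roots_eq)
  consider w where "w \<in> nth_roots d 1" "l = coordinate_line 1 2 w"
    | w where "w \<in> nth_roots d (- 2)" "l = coordinate_line 3 2 w"
    | w where "w \<in> nth_roots d (- 2)" "l = coordinate_line 3 1 w"
    using assms unfolding arrangement_def by blast
  then show ?thesis
  proof cases
    case 1
    then have "cluster d 3 \<inter> l = (\<lambda>q. hpoint w 1 q) ` nth_roots d (- 2)"
      unfolding cluster_3[OF d] by (auto simp: point_in_line_iff)
    then show ?thesis using inj[of "\<lambda>_. w" _ "\<lambda>x. x"] r by (simp add: card_image)
  next
    case 2
    then have "cluster d 3 \<inter> l = (\<lambda>r. hpoint r 1 w) ` nth_roots d 1"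
      unfolding cluster_3[OF d] by (auto simp: point_in_line_iff)
    then show ?thesis using inj[of "\<lambda>x. x" _ "\<lambda>_. w"] r by (simp add: card_image)
  next
    case 3
    \<comment> \<open>On this line \<open>q = w * r\<close>, so \<open>r\<close> alone parametrizes
      the points.\<close>
    have "cluster d 3 \<inter> l = (\<lambda>r. hpoint r 1 (w * r)) ` nth_roots d 1"
    proof (intro equalityI subsetI)
      fix p assume p: "p \<in> cluster d 3 \<inter> l"
      then obtain r q where rq: "r \<in> nth_roots d 1" "p = hpoint r 1 q"
        unfolding cluster_3[OF d] by auto
      then have "w = q / r" using p 3(2) point_in_line_iff(3) nth_roots_nz by simp
      then have "q = w * r" using nth_roots_nz rq(1) by simp
      then show "p \<in> (\<lambda>r. hpoint r 1 (w * r)) ` nth_roots d 1" using rq by blast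
    next
      fix p assume "p \<in> (\<lambda>r. hpoint r 1 (w * r)) ` nth_roots d 1"
      then obtain r where r: "r \<in> nth_roots d 1" "p = hpoint r 1 (w * r)" by blast
      have "w * r \<in> nth_roots d (- 2)" using r(1) 3(1) by (simp add: nth_roots_def power_mult_distrib)
      then show "p \<in> cluster d 3 \<inter> l"
        unfolding cluster_3[OF d] 3(2) using r point_in_line_iff(3) nth_roots_nz by auto
    qed
    then show ?thesis using inj[of "\<lambda>x. x" _ "\<lambda>x. w * x"] r by (simp add: card_image)
  qed
qed

lemma cluster_vertex_disjoint: "cluster d 3 \<inter> {hpoint 1 0 0, hpoint 0 1 0, hpoint 0 0 1} = {}"
proof -
  have "p \<notin> {hpoint 1 0 0, hpoint 0 1 0, hpoint 0 0 1}" if p: "p \<in> cluster d 3" for p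
  proof -
    obtain r q where rq: "r \<in> nth_roots d 1" "p = hpoint r 1 q"
      using p unfolding cluster_3[OF d] by auto
    then have "p \<in> coordinate_line 1 2 r" "p \<in> coordinate_line 3 2 q" "r \<noteq> 0"
      using nth_roots_nz by (simp_all add: point_in_line_iff)
    then show ?thesis using vertex_in_line_iff by auto
  qed
  then show ?thesis by blast
qed

lemma card_vertices: "card {hpoint 1 0 0, hpoint 0 1 0, hpoint 0 0 1} = 3"
proof -
  have "hpoint 1 0 0 \<noteq> hpoint 0 1 0" "hpoint 1 0 0 \<noteq> hpoint 0 0 1" "hpoint 0 1 0 \<noteq> hpoint 0 0 1"
    using vertex_in_line_iff(2,5,7,1,4)[of 1] vertex_in_line_iff(8)[of 1] by metis+
  then show ?thesis by simp
qed

text \<open>Two lines of one family meet in the vertex common to that family. Lines of different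
  families impose two of the equations \<open>x^d = y^d\<close>, \<open>z^d = -2 y^d\<close>,
  \<open>z^d = -2 x^d\<close>; any two imply the third and place the point in the cluster.\<close>

lemma intersection_points_arrangement:
  assumes "d \<ge> 2"
  shows "intersection_points (arrangement d) = cluster d 3 \<union> {hpoint 1 0 0, hpoint 0 1 0, hpoint 0 0 1}"
    (is "_ = _ \<union> ?E")
proof (intro equalityI subsetI)
  fix p assume p: "p \<in> cluster d 3 \<union> ?E"
  then have "2 \<le> card {l \<in> arrangement d. p \<in> l}"
  proof (elim UnE)
    assume "p \<in> cluster d 3"
    then show ?thesis using ordinary_point_cluster by (simp add: ordinary_point_def)
  next
    assume "p \<in> ?E"
    then show ?thesis using ordinary_point_vertex[of p] assms by (simp only: ordinary_point_def)
  qed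
  then have "finite {l \<in> arrangement d. p \<in> l}" "\<not> card {l \<in> arrangement d. p \<in> l} \<le> Suc 0"
    by (auto intro: card_ge_0_finite)
  then obtain l l' where "l \<in> arrangement d" "p \<in> l" "l' \<in> arrangement d" "p \<in> l'" "l \<noteq> l'"
    using card_le_Suc0_iff_eq by blast
  then show "p \<in> intersection_points (arrangement d)" unfolding intersection_points_def by blast
next
  fix p assume "p \<in> intersection_points (arrangement d)"
  then obtain l l' where l: "l \<in> arrangement d" "l' \<in> arrangement d" "l \<noteq> l'" "p \<in> l" "p \<in> l'"
    unfolding intersection_points_def by blast
  have "p \<in> proj_plane" using l(1,4) by (auto simp: arrangement_def coordinate_line_def)
  then obtain v where v: "v \<noteq> 0" "p = vec.span {v}" by (rule proj_planeE)
  have axis: "p = hpoint 1 0 0" if "v $ 2 = 0" "v $ 3 = 0"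
  proof -
    have "v = v $ 1 *s vector [1, 0, 0]" using that by (simp add: vec_eq_iff forall_3)
    moreover from this have "v $ 1 \<noteq> 0" using v(1) by auto
    ultimately show ?thesis unfolding v(2) hpoint_def using span_scale by metis
  qed
  have axis': "p = hpoint 0 1 0" if "v $ 1 = 0" "v $ 3 = 0"
  proof -
    have "v = v $ 2 *s vector [0, 1, 0]" using that by (simp add: vec_eq_iff forall_3)
    moreover from this have "v $ 2 \<noteq> 0" using v(1) by auto
    ultimately show ?thesis unfolding v(2) hpoint_def using span_scale by metis
  qed
  have axis'': "p = hpoint 0 0 1" if "v $ 1 = 0" "v $ 2 = 0"
  proof -
    have "v = v $ 3 *s vector [0, 0, 1]" using that by (simp add: vec_eq_iff forall_3)
    moreover from this have "v $ 3 \<noteq> 0" using v(1) by auto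
    ultimately show ?thesis unfolding v(2) hpoint_def using span_scale by metis
  qed
  show "p \<in> cluster d 3 \<union> ?E"
  proof (cases "v $ 1 ^ d = v $ 2 ^ d \<and> v $ 3 ^ d = - 2 * v $ 2 ^ d")
    case True
    then have "\<forall>j. j \<noteq> 3 \<longrightarrow> v $ 3 ^ d = - 2 * v $ j ^ d"
      by (simp add: forall_3)
    then show ?thesis unfolding v(2) using span_in_cluster_iff[OF v(1)] by blast
  next
    case False
    define on_B on_M on_N where
      "on_B m \<longleftrightarrow> (\<exists>w\<in>nth_roots d 1. m = coordinate_line 1 2 w \<and> v $ 1 = w * v $ 2)" and
      "on_M m \<longleftrightarrow> (\<exists>w\<in>nth_roots d (- 2). m = coordinate_line 3 2 w \<and> v $ 3 = w * v $ 2)" and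
      "on_N m \<longleftrightarrow> (\<exists>w\<in>nth_roots d (- 2). m = coordinate_line 3 1 w \<and> v $ 3 = w * v $ 1)" for m
    have on_line: "on_B m \<or> on_M m \<or> on_N m" if "m \<in> arrangement d" "p \<in> m" for m
      using that span_in_coordinate_line_iff[OF v(1)]
      unfolding v(2) arrangement_def on_B_def on_M_def on_N_def by blast
    have powers: "on_B m \<Longrightarrow> v $ 1 ^ d = v $ 2 ^ d" "on_M m \<Longrightarrow> v $ 3 ^ d = - 2 * v $ 2 ^ d"
      "on_N m \<Longrightarrow> v $ 3 ^ d = - 2 * v $ 1 ^ d" for m
      by (auto simp: on_B_def on_M_def on_N_def nth_roots_def power_mult_distrib)
    have zero: "x = 0 \<and> y = 0" if "x = w * y" "x = w' * y" "w \<noteq> w'" for w w' x y :: complex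
      using that by (metis mult_cancel_right mult_zero_right)
    \<comment> \<open>Outside the cluster at most one of the three equations holds, which leaves a
      single family for both lines.\<close>
    have same: "on_B l \<and> on_B l' \<or> on_M l \<and> on_M l' \<or> on_N l \<and> on_N l'"
      using on_line[OF l(1,4)] on_line[OF l(2,5)] powers[of l] powers[of l'] False by auto
    have "p = hpoint 0 0 1" if "on_B l" "on_B l'"
      using that axis'' zero[of "v $ 1" _ "v $ 2"] l(3) unfolding on_B_def by blast
    moreover have "p = hpoint 1 0 0" if "on_M l" "on_M l'"
      using that axis zero[of "v $ 3" _ "v $ 2"] l(3) unfolding on_M_def by blast
    moreover have "p = hpoint 0 1 0" if "on_N l" "on_N l'"
      using that axis' zero[of "v $ 3" _ "v $ 1"] l(3) unfolding on_N_def by blast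
    ultimately show ?thesis using same by blast
  qed
qed

end

theorem proposition3p4:
  fixes d :: nat and u \<zeta> :: complex
  assumes "d \<ge> 3"
    and "primitive_root_of_unity (2 * d) u"
    and "primitive_root_of_unity d \<zeta>"
  shows "let S = s_cluster d u \<zeta>;
             K = clusters d u \<zeta>;
             A = lines_of (B_z d) \<union> lines_of (M_x d) \<union> lines_of (N_y d);
             E = {hpoint 1 0 0, hpoint 0 1 0, hpoint 0 0 1}
         in
           card {p. sextactic_point (fermat d) p} = 3 * d\<^sup>2 \<and>
           {p. sextactic_point (fermat d) p} = \<Union>K \<and>
           S \<in> K \<and> card K = 3 \<and> disjoint K \<and> (\<forall>C\<in>K. card C = d\<^sup>2) \<and>
           (\<forall>G\<in>{B_z d, M_x d, N_y d}. card (lines_of G) = d \<and> \<Union>(lines_of G) = zero_locus G) \<and>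
           card A = 3 * d \<and>
           (\<forall>l\<in>A. card (S \<inter> l) = d) \<and>
           intersection_points A = S \<union> E \<and>
           S \<inter> E = {} \<and> card S = d\<^sup>2 \<and> card E = 3 \<and>
           (\<forall>p\<in>S. ordinary_point A 3 p) \<and>
           (\<forall>p\<in>E. ordinary_point A d p)"
proof -
  have d: "d > 0" "d \<ge> 2" using assms(1) by simp_all
  show ?thesis
    unfolding Let_def s_cluster_eq[OF assms(2,3)] clusters_eq[OF assms(2,3)] arrangement_eq[OF d(1)]
      sextactic_points_eq[OF assms(1)]
    using card_sextactic_points[OF d(1)] card_clusters[OF d(1)] disjoint_range_cluster[OF d(1)]
      card_cluster[OF d(1)] card_lines_of[OF d(1)] card_arrangement[OF d(1)] card_cluster_line[OF d(1)]
      intersection_points_arrangement[OF d] cluster_vertex_disjoint[OF d(1)] card_vertices[OF d(1)]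
      ordinary_point_cluster[OF d(1)] ordinary_point_vertex[OF d(1)]
    by (intro conjI) blast+
qed

end
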